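(* Let $G$ be a bipartite graph with $m$ left vertices and let $k_1,\dots,k_m$ be nonnegative integers. Suppose that $Q_G(k_1,\dots,k_m)$ is $d$-dimensional. Then the number of lattice points on the (relative) boundary of $Q_G(k_1,\dots,k_m)$ is $$\begin{cases}2\displaystyle\sum_{\boldsymbol a\in D^1(G)}\prod_{i=1}^m c(a_i,k_i),& d\text{ even},\\[6pt] 2\displaystyle\sum_{\boldsymbol a\in D^0(G)}\prod_{i=1}^m c(a_i,k_i),& d\text{ odd}.\end{cases}$$ In particular (the case $k_1=\dots=k_m=1$), the number of lattice points on the boundary of $Q_G(1,\dots,1)$, where $d=\dim Q_G(1,\dots,1)$, is $2F_{G,1}(2)$ if $d$ is even and $2F_{G,0}(2)$ if $d$ is odd.
   Context: $G$ is a bipartite graph with left vertices $\ell_1,\dots,\ell_m$ and right vertices $r_1,\dots,r_n$; $I_j=\{i\in[n]\mid\ell_j\text{ is adjacent to }r_i\}$ for $j\in[m]$. A $G$-draconian sequence is a sequence $\boldsymbol a=(a_1,\dots,a_m)$ of nonnegative integers such that $\sum_{i\in J}a_i\le|\bigcup_{i\in J}I_i|$ for every nonempty $J\subset[m]$; $D(G)$ is the set of all of them. With $|\boldsymbol a|=a_1+\cdots+a_m$, $D^0(G)$ (resp. $D^1(G)$) is the set of $\boldsymbol a\in D(G)$ with $|\boldsymbol a|$ even (resp. odd). $s(\boldsymbol a)$ is the number of positive coordinates of $\boldsymbol a$, and $F_{G,\epsilon}(z)=\sum_{\boldsymbol a\in D^\epsilon(G)}z^{s(\boldsymbol a)}$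 for $\epsilon\in\{0,1\}$. For nonempty $I\subset[n]$, $\diamondsuit_I=\operatorname{conv}(\pm\boldsymbol e_i\mid i\in I)\subset\mathbb R^n$, and $\diamondsuit_\varnothing=\{\boldsymbol 0\}$. $Q_G(k_1,\dots,k_m)=k_1\diamondsuit_{I_1}+\cdots+k_m\diamondsuit_{I_m}$ (Minkowski sum). Lattice points are points of $\mathbb Z^n$; the boundary is the complement in the polytope of its relative interior. For nonnegative integers $a,k$, $c(a,k)$ is the number of $\boldsymbol x\in\mathbb Z^k$ with $|x_1|+\cdots+|x_k|=a$ (with $c(0,0)=1$ and $c(a,0)=0$ for $a>0$). *)

theory Defs
  imports "HOL-Analysis.Analysis" "HOL-Computational_Algebra.Polynomial"
begin

text \<open>
  A bipartite graph has left vertices \<open>1, \<dots>, m\<close> and right vertices the elements of the finite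
  type \<open>'n\<close>, so that its polytopes live in \<open>real ^ 'n\<close>. The graph is given by \<open>m\<close> together with
  its edge set, each edge being written as a pair (left vertex, right vertex).
\<close>

definition bipartite_graph :: "nat \<Rightarrow> (nat \<times> 'n::finite) set \<Rightarrow> bool" where
  "bipartite_graph m E \<longleftrightarrow> E \<subseteq> {1..m} \<times> UNIV"

definition nbrs :: "(nat \<times> 'n::finite) set \<Rightarrow> nat \<Rightarrow> 'n set" where
  "nbrs E j = {i. (j, i) \<in> E}"

text \<open>
  A sequence \<open>(a\<^sub>1, \<dots>, a\<^sub>m)\<close> is an extensional function on \<open>{1..m}\<close>, so that distinct elements of
  the following set are distinct sequences.
\<close>

definition draconian :: "nat \<Rightarrow> (nat \<times> 'n::finite) set \<Rightarrow> (nat \<Rightarrow> nat) set" where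
  "draconian m E = {a \<in> {1..m} \<rightarrow>\<^sub>E UNIV.
     \<forall>J. J \<noteq> {} \<and> J \<subseteq> {1..m} \<longrightarrow> (\<Sum>i\<in>J. a i) \<le> card (\<Union>i\<in>J. nbrs E i)}"

definition draconian_parity :: "nat \<Rightarrow> (nat \<times> 'n::finite) set \<Rightarrow> nat \<Rightarrow> (nat \<Rightarrow> nat) set" where
  "draconian_parity m E \<epsilon> = {a \<in> draconian m E. (\<Sum>i=1..m. a i) mod 2 = \<epsilon>}"

definition num_pos :: "nat \<Rightarrow> (nat \<Rightarrow> nat) \<Rightarrow> nat" where
  "num_pos m a = card {i \<in> {1..m}. a i > 0}"

definition F_poly :: "nat \<Rightarrow> (nat \<times> 'n::finite) set \<Rightarrow> nat \<Rightarrow> nat poly" where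
  "F_poly m E \<epsilon> = (\<Sum>a\<in>draconian_parity m E \<epsilon>. monom 1 (num_pos m a))"

definition cross_polytope :: "'n::finite set \<Rightarrow> (real ^ 'n) set" where
  "cross_polytope I =
     (if I = {} then {0} else convex hull (\<Union>i\<in>I. {axis i 1, - axis i 1}))"

text \<open>The sum below is the Minkowski sum of sets; it is \<open>{0}\<close> if \<open>m = 0\<close>.\<close>

definition Q_polytope :: "nat \<Rightarrow> (nat \<times> 'n::finite) set \<Rightarrow> (nat \<Rightarrow> nat) \<Rightarrow> (real ^ 'n) set" where
  "Q_polytope m E k = (\<Sum>j=1..m. (\<lambda>x. real (k j) *\<^sub>R x) ` cross_polytope (nbrs E j))"

definition boundary_lattice_points :: "(real ^ 'n::finite) set \<Rightarrow> (real ^ 'n) set" where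
  "boundary_lattice_points P = {x \<in> P - rel_interior P. \<forall>i. x $ i \<in> \<int>}"

text \<open>Integer vectors of length \<open>k\<close> are represented as lists, which includes \<open>k = 0\<close>.\<close>

definition c :: "nat \<Rightarrow> nat \<Rightarrow> nat" where
  "c a k = card {xs :: int list. length xs = k \<and> (\<Sum>x\<leftarrow>xs. \<bar>x\<bar>) = int a}"

end

theory Submission
  imports Defs
begin

text \<open>
  The lattice points of \<open>Q_G(k)\<close> are the integer vectors whose absolute values \<open>b\<close> satisfy
  \<open>b(S) \<le> |N(S)|\<close> for every set \<open>S\<close> of right vertices of the graph \<open>G'\<close> with \<open>k\<^sub>j\<close> copies of the
  \<open>j\<close>-th left vertex, and the relative interior corresponds to strict inequalities for nonempty
  \<open>S\<close>. Hence both counts are sums of \<open>2\<^bsup>|supp b|\<^esup>\<close> over right degree vectors, and these have to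
  be converted into sums over left degree vectors, i.e. draconian sequences.

  The source of all such conversions is the duality for hypertrees: \<open>G\<close> and its transpose have
  equally many (Kalman, Postnikov). It is proved by deleting an edge \<open>(l, r)\<close>. A hypertree that is
  lost has a largest violated set \<open>S \<ni> r\<close>, and it splits into a hypertree on \<open>S\<close> and one on the
  complement of \<open>S\<close>; the admissible splittings are pairs \<open>(J, S)\<close> with \<open>(l, r)\<close> the only edge between
  \<open>J\<close> and \<open>S\<close>, a condition that is symmetric under transposition.

  Adding vertices adjacent to everything turns the duality into statements on draconian sequences.
  An induction then shows that the positive ones on \<open>A\<close> are equinumerous with the sets perfectly
  matched with \<open>A\<close>, which gives the count of all lattice points. For the interior points,
  inclusion-exclusion over supports leads to draconian sequences \<open>p\<close> together with the sets matched
  to \<open>p\<close>; taking \<open>p\<^sub>i\<close> copies of each left vertex \<open>i\<close> rewrites these, and the sum over \<open>p\<close>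
  collapses because the compositions of \<open>n > 0\<close>, weighted by \<open>(-2)\<close> to the number of parts, add up to \<open>2 (-1)\<^sup>n\<close>. So
  interior points are counted like all points, up to the sign \<open>(-1)\<^bsup>d + |a|\<^esup>\<close>, and the difference
  is twice the sum over \<open>|a| \<equiv> d + 1\<close> modulo 2.
\<close>

section \<open>Duality for hypertrees\<close>

text \<open>The left vertex set is an argument, so that an induced subgraph is obtained by shrinking
  vertex sets while the edge set \<open>E\<close> stays fixed.\<close>

definition nb :: "('a \<times> 'b) set \<Rightarrow> 'a set \<Rightarrow> 'b set \<Rightarrow> 'a set" where
  "nb E L S = {i \<in> L. \<exists>r\<in>S. (i, r) \<in> E}"

text \<open>The right degrees minus one of the spanning trees, described by inequalities.\<close>

definition hypertrees :: "('a \<times> 'b) set \<Rightarrow> 'a set \<Rightarrow> 'b set \<Rightarrow> ('b \<Rightarrow> nat) set" where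
  "hypertrees E L R = {b. (\<forall>r. r \<notin> R \<longrightarrow> b r = 0) \<and>
     (\<forall>S. S \<subseteq> R \<and> S \<noteq> {} \<longrightarrow> sum b S < card (nb E L S)) \<and> Suc (sum b R) = card L}"

lemma hypertreesI:
  assumes "\<And>r. r \<notin> R \<Longrightarrow> b r = 0"
    and "\<And>S. S \<subseteq> R \<Longrightarrow> S \<noteq> {} \<Longrightarrow> sum b S < card (nb E L S)"
    and "Suc (sum b R) = card L"
  shows "b \<in> hypertrees E L R"
  using assms by (simp add: hypertrees_def)

lemma hypertreesD:
  assumes "b \<in> hypertrees E L R"
  shows "r \<notin> R \<Longrightarrow> b r = 0" and "S \<subseteq> R \<Longrightarrow> S \<noteq> {} \<Longrightarrow> sum b S < card (nb E L S)"
    and "Suc (sum b R) = card L"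
  using assms by (simp_all add: hypertrees_def)

lemma nb_subset: "nb E L S \<subseteq> L"
  by (auto simp: nb_def)

lemma finite_nb [simp]: "finite L \<Longrightarrow> finite (nb E L S)"
  by (auto simp: nb_def)

lemma nb_mono: "S \<subseteq> T \<Longrightarrow> nb E L S \<subseteq> nb E L T"
  by (auto simp: nb_def)

lemma finite_bounded_supported:
  assumes "finite R"
  shows "finite {b :: 'b \<Rightarrow> nat. (\<forall>r. r \<notin> R \<longrightarrow> b r = 0) \<and> (\<forall>r\<in>R. b r \<le> M)}"
proof -
  have "{b. (\<forall>r. r \<notin> R \<longrightarrow> b r = 0) \<and> (\<forall>r\<in>R. b r \<le> M)} =
      {b. \<forall>r. (r \<in> R \<longrightarrow> b r \<in> {..M}) \<and> (r \<notin> R \<longrightarrow> b r = 0)}"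
    by auto
  then show ?thesis
    using finite_set_of_finite_funs[OF assms, of "{..M}" 0] by simp
qed

lemma finite_hypertrees [simp]:
  assumes "finite L" "finite R"
  shows "finite (hypertrees E L R)"
proof (rule finite_subset[OF _ finite_bounded_supported[OF \<open>finite R\<close>, of "card L"]], clarsimp, intro conjI allI impI ballI)
  fix b r
  assume b: "b \<in> hypertrees E L R"
  show "r \<notin> R \<Longrightarrow> b r = 0" using b by (auto simp: hypertrees_def)
  assume "r \<in> R"
  then have "b r < card (nb E L {r})"
    using b by (auto simp: hypertrees_def dest: spec[of _ "{r}"])
  also have "\<dots> \<le> card L" by (intro card_mono nb_subset assms)
  finally show "b r \<le> card L" by simp
qed

section \<open>Gluing and splitting hypertrees along an edge\<close>

lemma sum_restrict_support:
  fixes b :: "'b \<Rightarrow> nat"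
  assumes "finite X" "\<forall>r. r \<notin> R \<longrightarrow> b r = 0"
  shows "sum b X = sum b (X \<inter> R)"
  using assms by (intro sum.mono_neutral_right) auto

text \<open>A subset of \<open>S\<close> containing \<open>r\<close> gains the neighbour
  \<open>l\<close> outside \<open>L - J\<close>, and this pays for the extra unit at
  \<open>r\<close>. By the second and third conclusions \<open>S\<close> becomes violated when the
  edge is deleted; by the fourth every violated set lies in \<open>S\<close>. Hence
  \<open>S\<close>, and with it \<open>J\<close>, can be recovered from \<open>b\<close>.\<close>

lemma hypertrees_glue:
  fixes E :: "('a \<times> 'b) set"
  assumes fin: "finite L" "finite R" and J: "l \<in> J" "J \<subseteq> L" and S: "r \<in> S" "S \<subseteq> R"
    and cross: "E \<inter> (J \<times> S) = {(l, r)}"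
    and b1: "b1 \<in> hypertrees E (L - J) S" and b2: "b2 \<in> hypertrees E J (R - S)"
  defines "b \<equiv> \<lambda>x. b1 x + b2 x + of_bool (x = r)"
  shows "b \<in> hypertrees E L R"
    and "nb (E - {(l, r)}) L S = L - J"
    and "sum b S = card (L - J)"
    and "\<And>X. X \<subseteq> R \<Longrightarrow> \<not> X \<subseteq> S \<Longrightarrow> sum b X < card (nb (E - {(l, r)}) L X)"
proof -
  let ?E = "E - {(l, r)}"
  have finJ: "finite J" using fin J finite_subset by blast
  have z1: "\<forall>x. x \<notin> S \<longrightarrow> b1 x = 0" and z2: "\<forall>x. x \<notin> R - S \<longrightarrow> b2 x = 0"
    using b1 b2 by (auto simp: hypertrees_def)
  have lt1: "sum b1 X < card (nb E (L - J) X)" if "X \<subseteq> S" "X \<noteq> {}" for X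
    using b1 that by (auto simp: hypertrees_def)
  have lt2: "sum b2 X < card (nb E J X)" if "X \<subseteq> R - S" "X \<noteq> {}" for X
    using b2 that by (auto simp: hypertrees_def)
  have t1: "Suc (sum b1 S) = card (L - J)" and t2: "Suc (sum b2 (R - S)) = card J"
    using b1 b2 by (auto simp: hypertrees_def)
  have sb: "sum b X = sum b1 (X \<inter> S) + sum b2 (X - S) + of_bool (r \<in> X)" if "X \<subseteq> R" for X
  proof -
    have f: "finite X" using that fin finite_subset by blast
    have "sum b X = sum b1 X + sum b2 X + (\<Sum>x\<in>X. of_bool (x = r))"
      by (simp add: b_def sum.distrib)
    also have "(\<Sum>x\<in>X. of_bool (x = r)) = (of_bool (r \<in> X) :: nat)"
      using f by (simp add: of_bool_def)
    also have "sum b1 X = sum b1 (X \<inter> S)" by (rule sum_restrict_support[OF f z1])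
    also have "sum b2 X = sum b2 (X \<inter> (R - S))" by (rule sum_restrict_support[OF f z2])
    also have "X \<inter> (R - S) = X - S" using that by auto
    finally show ?thesis .
  qed
  \<comment> \<open>Neither of the two neighbourhoods uses the deleted edge, which joins
    \<open>J\<close> to \<open>S\<close>, and they are disjoint.\<close>
  have nb': "card (nb E (L - J) (X \<inter> S)) + card (nb E J (X - S)) \<le> card (nb ?E L X)" for X
  proof -
    have "card (nb E (L - J) (X \<inter> S)) + card (nb E J (X - S))
        = card (nb E (L - J) (X \<inter> S) \<union> nb E J (X - S))"
      by (rule card_Un_disjoint[symmetric]) (use fin finJ in \<open>auto simp: nb_def\<close>)
    also have "\<dots> \<le> card (nb ?E L X)"
      by (intro card_mono) (use fin J S in \<open>auto simp: nb_def\<close>)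
    finally show ?thesis .
  qed
  have nb_r: "card (nb E (L - J) X) + of_bool (r \<in> X) \<le> card (nb E L X)" if "X \<subseteq> S" for X
  proof (cases "r \<in> X")
    case True
    have "card (nb E (L - J) X) + 1 = card (insert l (nb E (L - J) X))"
      using fin J by (subst card_insert_disjoint) (auto simp: nb_def)
    also have "\<dots> \<le> card (nb E L X)"
      using fin J True cross by (intro card_mono) (auto simp: nb_def)
    finally show ?thesis using True by simp
  next
    case False
    then show ?thesis using fin by (auto simp: nb_def intro!: card_mono)
  qed
  have E': "card (nb ?E L X) \<le> card (nb E L X)" for X
    using fin by (intro card_mono) (auto simp: nb_def)
  show large: "sum b X < card (nb ?E L X)" if X: "X \<subseteq> R" "\<not> X \<subseteq> S" for X
  proof (cases "X \<inter> S = {}")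
    case True
    have "sum b2 (X - S) < card (nb E J (X - S))" using X by (intro lt2) auto
    moreover have "r \<notin> X" using True S by auto
    ultimately show ?thesis using sb[OF X(1)] nb'[of X] True by simp
  next
    case False
    \<comment> \<open>Two strict inequalities add up to a slack of two, of which the unit at
      \<open>r\<close> uses at most one.\<close>
    have "sum b2 (X - S) < card (nb E J (X - S))" using X by (intro lt2) auto
    moreover have "sum b1 (X \<inter> S) < card (nb E (L - J) (X \<inter> S))" using False by (intro lt1) auto
    ultimately show ?thesis using sb[OF X(1)] nb'[of X] by (auto simp: of_bool_def)
  qed
  have nbK: "nb E (L - J) S = L - J"
  proof (intro card_seteq nb_subset)
    have "S \<noteq> {}" using S by auto
    then show "card (L - J) \<le> card (nb E (L - J) S)" using t1 lt1[of S] by simp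
  qed (use fin in simp)
  show "nb ?E L S = L - J"
  proof -
    have "nb ?E L S = nb E (L - J) S"
      using J S cross by (auto simp: nb_def)
    then show ?thesis using nbK by simp
  qed
  show "sum b S = card (L - J)"
    using sb[OF S(2)] t1 S by simp
  have "sum b X < card (nb E L X)" if X: "X \<subseteq> R" "X \<noteq> {}" for X
  proof (cases "X \<subseteq> S")
    case True
    then have "X \<inter> S = X" and "X - S = {}" by auto
    then have "sum b X = sum b1 X + of_bool (r \<in> X)" using sb[OF X(1)] by (simp only: sum.empty)
    then show ?thesis using lt1[OF True X(2)] nb_r[OF True] by simp
  next
    case False
    then show ?thesis using large[OF X(1) False] E'[of X] by simp
  qed
  moreover have "Suc (sum b R) = card L"
  proof -
    have "R \<inter> S = S" using S by auto
    moreover have "card L = card (L - J) + card J"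
      using fin J by (metis card_Diff_subset card_mono finite_subset le_add_diff_inverse2)
    ultimately show ?thesis using sb[of R] t1 t2 S by auto
  qed
  moreover have "\<forall>x. x \<notin> R \<longrightarrow> b x = 0"
    using z1 z2 S by (auto simp: b_def)
  ultimately show "b \<in> hypertrees E L R" by (auto simp: hypertrees_def)
qed

text \<open>The inverse of gluing: \<open>S\<close> is a largest set violated after the deletion of
  the edge, and \<open>J\<close> is the set of left vertices that \<open>S\<close> no longer
  reaches.\<close>

lemma hypertrees_split:
  fixes E :: "('a \<times> 'b) set"
  assumes fin: "finite L" "finite R" and l: "l \<in> L" and r: "r \<in> R" and e: "(l, r) \<in> E"
    and npend: "\<exists>i\<in>L - {l}. (i, r) \<in> E"
    and b: "b \<in> hypertrees E L R" "b \<notin> hypertrees (E - {(l, r)}) L R"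
  obtains J S b1 b2 where "l \<in> J" "J \<subseteq> L" "r \<in> S" "S \<subseteq> R" "E \<inter> (J \<times> S) = {(l, r)}"
    "b1 \<in> hypertrees E (L - J) S" "b2 \<in> hypertrees E J (R - S)"
    "b = (\<lambda>x. b1 x + b2 x + of_bool (x = r))"
proof -
  let ?E = "E - {(l, r)}"
  define bad where "bad X \<longleftrightarrow> X \<subseteq> R \<and> X \<noteq> {} \<and> \<not> sum b X < card (nb ?E L X)" for X
  have lt: "sum b X < card (nb E L X)" if "X \<subseteq> R" "X \<noteq> {}" for X
    using b that by (auto simp: hypertrees_def)
  have tot: "Suc (sum b R) = card L" and z: "\<forall>x. x \<notin> R \<longrightarrow> b x = 0"
    using b by (auto simp: hypertrees_def)
  obtain X0 where "bad X0" using b by (auto simp: hypertrees_def bad_def)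
  have "\<forall>X. bad X \<longrightarrow> card X < Suc (card R)"
    using fin by (auto simp: bad_def less_Suc_eq_le intro: card_mono)
  then obtain S where S: "bad S" and Smax: "\<And>X. bad X \<Longrightarrow> card X \<le> card S"
    using ex_has_greatest_nat[of bad X0 card "Suc (card R)"] \<open>bad X0\<close> by blast
  have SR: "S \<subseteq> R" "S \<noteq> {}" using S by (auto simp: bad_def)
  have fS: "finite S" using SR fin finite_subset by blast
  have sub: "nb E L S \<subseteq> insert l (nb ?E L S)" by (auto simp: nb_def)
  have ge: "card (nb ?E L S) \<le> sum b S" using S by (auto simp: bad_def)
  have ne: "nb E L S \<noteq> nb ?E L S" using lt[OF SR] ge by auto
  have rS: "r \<in> S" using ne by (auto simp: nb_def)
  have lnot: "l \<notin> nb ?E L S" using ne sub rS l e by (auto simp: nb_def)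
  have nbeq: "nb E L S = insert l (nb ?E L S)" using sub l rS e by (auto simp: nb_def)
  \<comment> \<open>The deletion costs \<open>S\<close> only the neighbour \<open>l\<close>, so a
    strict inequality that fails afterwards fails with equality.\<close>
  have sumS: "sum b S = card (nb ?E L S)"
    using lt[OF SR] ge nbeq lnot fin by (simp add: card_insert_if)
  define J where "J = L - nb ?E L S"
  have J: "l \<in> J" "J \<subseteq> L" using l lnot by (auto simp: J_def)
  have LJ: "L - J = nb ?E L S" by (auto simp: J_def nb_def)
  have cross: "E \<inter> (J \<times> S) = {(l, r)}"
  proof (intro equalityI subsetI)
    fix p assume "p \<in> E \<inter> (J \<times> S)"
    then obtain i s where p: "p = (i, s)" "(i, s) \<in> E" "i \<in> L" "i \<notin> nb ?E L S" "s \<in> S"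
      unfolding J_def by blast
    then have "(i, s) \<notin> ?E" unfolding nb_def by blast
    then show "p \<in> {(l, r)}" using p by blast
  qed (use J rS e in blast)
  have nbJ: "nb E (L - J) X = nb ?E L X" if "X \<subseteq> S" for X
    using that lnot unfolding LJ by (auto simp: nb_def)
  have br: "b r \<ge> 1"
  \<comment> \<open>If \<open>b r\<close> were 0, \<open>S - {r}\<close> would carry the same sum as
    \<open>S\<close>. Its neighbours avoid the deleted edge, so its own strict inequality
    contradicts \<open>sumS\<close>. For \<open>S = {r}\<close> the second neighbour of
    \<open>r\<close> from \<open>npend\<close> does the same.\<close>
  proof (rule ccontr)
    assume "\<not> b r \<ge> 1"
    then have "sum b S = sum b (S - {r})" using fS rS by (simp add: sum.remove)
    moreover have "sum b (S - {r}) < card (nb ?E L S)"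
    proof (cases "S - {r} = {}")
      case True
      obtain i where "i \<in> L" "i \<noteq> l" "(i, r) \<in> E" using npend by auto
      then have "i \<in> nb ?E L S" using rS by (auto simp: nb_def)
      then have "card (nb ?E L S) > 0" using fin by (auto simp: card_gt_0_iff)
      moreover have "sum b (S - {r}) = 0" by (simp only: True sum.empty)
      ultimately show ?thesis by simp
    next
      case False
      have "sum b (S - {r}) < card (nb E L (S - {r}))" using SR False by (intro lt) auto
      also have "\<dots> \<le> card (nb ?E L S)" using fin by (intro card_mono) (auto simp: nb_def)
      finally show ?thesis .
    qed
    ultimately show False using sumS by simp
  qed
  \<comment> \<open>The truncated subtraction is exact by \<open>br\<close>.\<close>
  define b1 where "b1 = (\<lambda>x. if x \<in> S then b x - of_bool (x = r) else 0)"
  define b2 where "b2 = (\<lambda>x. if x \<in> S then 0 else b x)"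
  have sb1: "sum b X = sum b1 X + of_bool (r \<in> X)" if "X \<subseteq> S" for X
  proof -
    have "finite X" using that fS finite_subset by blast
    have "sum b X = (\<Sum>x\<in>X. b1 x + of_bool (x = r))"
      using that br by (intro sum.cong) (auto simp: b1_def)
    also have "\<dots> = sum b1 X + of_bool (r \<in> X)"
      using \<open>finite X\<close> by (simp add: sum.distrib of_bool_def)
    finally show ?thesis .
  qed
  have b1: "b1 \<in> hypertrees E (L - J) S"
  proof (rule hypertreesI)
    fix X assume X: "X \<subseteq> S" "X \<noteq> {}"
    show "sum b1 X < card (nb E (L - J) X)"
    proof (cases "r \<in> X")
      case True
      have "nb E L X = insert l (nb ?E L X)" "l \<notin> nb ?E L X"
        using True l e lnot X by (auto simp: nb_def)
      then have "card (nb E L X) = Suc (card (nb ?E L X))" using fin by simp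
      moreover have "sum b X < card (nb E L X)" using X SR by (intro lt) auto
      ultimately show ?thesis using sb1[OF X(1)] True nbJ[OF X(1)] by simp
    next
      case False
      have "nb E L X = nb ?E L X" using False by (auto simp: nb_def)
      moreover have "sum b X < card (nb E L X)" using X SR by (intro lt) auto
      ultimately show ?thesis using sb1[OF X(1)] False nbJ[OF X(1)] by simp
    qed
  next
    show "Suc (sum b1 S) = card (L - J)" using sb1[of S] rS sumS LJ by simp
  qed (simp add: b1_def)
  have b2eq: "sum b2 X = sum b X" if "X \<subseteq> R - S" for X
    using that by (intro sum.cong) (auto simp: b2_def)
  have b2: "b2 \<in> hypertrees E J (R - S)"
  proof (rule hypertreesI)
    fix X assume X: "X \<subseteq> R - S" "X \<noteq> {}"
    have fX: "finite X" using X fin by (meson finite_Diff finite_subset)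
    \<comment> \<open>By maximality of \<open>S\<close> the union \<open>S \<union> X\<close> is not
      violated; subtracting the equality \<open>sumS\<close> leaves the inequality for
      \<open>X\<close> in \<open>J\<close>.\<close>
    have "card S < card (S \<union> X)"
      using X fX fS by (intro psubset_card_mono) auto
    then have "\<not> bad (S \<union> X)" using Smax[of "S \<union> X"] by linarith
    then have "sum b (S \<union> X) < card (nb ?E L (S \<union> X))"
      using X SR by (auto simp: bad_def)
    also have "nb ?E L (S \<union> X) = nb ?E L S \<union> nb E J X"
      using X rS by (auto simp: nb_def J_def)
    also have "card \<dots> = card (nb ?E L S) + card (nb E J X)"
      using fin J by (intro card_Un_disjoint) (auto simp: nb_def J_def)
    also have "sum b (S \<union> X) = sum b S + sum b X"
      using X fX fS by (intro sum.union_disjoint) auto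
    finally show "sum b2 X < card (nb E J X)" using sumS b2eq[OF X(1)] by simp
  next
    have "sum b R = sum b S + sum b (R - S)"
      using SR fin by (metis sum.subset_diff add.commute)
    moreover have "card J = card L - card (nb ?E L S)" "card (nb ?E L S) \<le> card L"
      using fin by (simp_all add: J_def card_Diff_subset card_mono nb_subset)
    ultimately show "Suc (sum b2 (R - S)) = card J"
      using b2eq[of "R - S"] tot sumS by simp
  qed (use z in \<open>auto simp: b2_def\<close>)
  have "b = (\<lambda>x. b1 x + b2 x + of_bool (x = r))"
    using br rS by (auto simp: b1_def b2_def fun_eq_iff)
  with that[OF J rS SR(1) cross b1 b2] show ?thesis by blast
qed

text \<open>The hypertrees lost with the edge correspond to an admissible pair \<open>(J, S)\<close>
  together with a hypertree on each of the two pieces. The recursion is self-dual, since the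
  condition in \<open>P\<close> keeps its form when left and right are exchanged.\<close>

lemma card_hypertrees_delete_edge:
  fixes E :: "('a \<times> 'b) set"
  assumes fin: "finite L" "finite R" and l: "l \<in> L" and r: "r \<in> R" and e: "(l, r) \<in> E"
    and npend: "\<exists>i\<in>L - {l}. (i, r) \<in> E"
  defines "P \<equiv> {(J, S). l \<in> J \<and> J \<subseteq> L \<and> r \<in> S \<and> S \<subseteq> R \<and> E \<inter> (J \<times> S) = {(l, r)}}"
  shows "card (hypertrees E L R) = card (hypertrees (E - {(l, r)}) L R) +
     (\<Sum>(J, S)\<in>P. card (hypertrees E (L - J) S) * card (hypertrees E J (R - S)))"
proof -
  let ?E = "E - {(l, r)}"
  let ?H = "\<lambda>p. hypertrees E (L - fst p) (snd p) \<times> hypertrees E (fst p) (R - snd p)"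
  let ?f = "\<lambda>(p, b1, b2) x. b1 x + b2 x + of_bool (x = r) :: nat"
  have sub: "hypertrees ?E L R \<subseteq> hypertrees E L R"
  proof
    fix b assume b: "b \<in> hypertrees ?E L R"
    have "card (nb ?E L S) \<le> card (nb E L S)" for S
      using fin by (intro card_mono) (auto simp: nb_def)
    then show "b \<in> hypertrees E L R"
      using b unfolding hypertrees_def by (blast intro: less_le_trans)
  qed
  have "P \<subseteq> Pow L \<times> Pow R" by (auto simp: P_def)
  then have finP: "finite P" using fin finite_subset by blast
  have "bij_betw ?f (Sigma P ?H) (hypertrees E L R - hypertrees ?E L R)"
    unfolding bij_betw_def
  proof
    show "inj_on ?f (Sigma P ?H)"
    proof (rule inj_onI)
      fix u v assume u: "u \<in> Sigma P ?H" and v: "v \<in> Sigma P ?H" and uv: "?f u = ?f v"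
      obtain J S b1 b2 where u_eq: "u = ((J, S), b1, b2)" by (metis surj_pair)
      obtain J' S' b1' b2' where v_eq: "v = ((J', S'), b1', b2')" by (metis surj_pair)
      have 1: "(J, S) \<in> P" "b1 \<in> hypertrees E (L - J) S" "b2 \<in> hypertrees E J (R - S)"
        and 2: "(J', S') \<in> P" "b1' \<in> hypertrees E (L - J') S'" "b2' \<in> hypertrees E J' (R - S')"
        using u v by (simp_all add: u_eq v_eq)
      have eq: "(\<lambda>x. b1 x + b2 x + of_bool (x = r)) = (\<lambda>x. b1' x + b2' x + of_bool (x = r))"
        using uv by (simp add: u_eq v_eq)
      have J: "l \<in> J" "J \<subseteq> L" "r \<in> S" "S \<subseteq> R" "E \<inter> (J \<times> S) = {(l, r)}"
        and J': "l \<in> J'" "J' \<subseteq> L" "r \<in> S'" "S' \<subseteq> R" "E \<inter> (J' \<times> S') = {(l, r)}"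
        using 1 2 by (simp_all add: P_def)
      note g = hypertrees_glue[OF fin J] note g' = hypertrees_glue[OF fin J']
      have f: "b1 \<in> hypertrees E (L - J) S" "b2 \<in> hypertrees E J (R - S)"
        "b1' \<in> hypertrees E (L - J') S'" "b2' \<in> hypertrees E J' (R - S')"
        using 1 2 by simp_all
      \<comment> \<open>Both decompositions belong to the same function: \<open>S'\<close> is
        violated without the edge, and all violated sets lie in \<open>S\<close>.\<close>
      have "S' \<subseteq> S"
        using g(4)[OF f(1,2) J'(4)] g'(2,3)[OF f(3,4)] unfolding eq by fastforce
      moreover have "S \<subseteq> S'"
        using g'(4)[OF f(3,4) J(4)] g(2,3)[OF f(1,2)] unfolding eq by fastforce
      ultimately have S: "S' = S" by simp
      have "L - J = L - J'" using g(2)[OF f(1,2)] g'(2)[OF f(3,4)] S by simp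
      then have JJ: "J' = J" using J J' by blast
      have z: "\<And>x. x \<notin> S \<Longrightarrow> b1 x = 0" "\<And>x. x \<notin> S \<Longrightarrow> b1' x = 0"
        "\<And>x. x \<in> S \<Longrightarrow> b2 x = 0" "\<And>x. x \<in> S \<Longrightarrow> b2' x = 0"
        using f S by (auto simp: hypertrees_def)
      have eq': "b1 x + b2 x = b1' x + b2' x" for x
        using fun_cong[OF eq, of x] by simp
      \<comment> \<open>The two summands have disjoint supports, so their sum determines
        them.\<close>
      have "b1 x = b1' x \<and> b2 x = b2' x" for x
        using eq'[of x] z[of x] by (cases "x \<in> S") auto
      then show "u = v" using S JJ by (auto simp: u_eq v_eq)
    qed
    show "?f ` Sigma P ?H = hypertrees E L R - hypertrees ?E L R"
    proof (intro equalityI subsetI)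
      fix b assume "b \<in> ?f ` Sigma P ?H"
      then obtain J S b1 b2 where 1: "(J, S) \<in> P" "b1 \<in> hypertrees E (L - J) S" "b2 \<in> hypertrees E J (R - S)"
        and b: "b = (\<lambda>x. b1 x + b2 x + of_bool (x = r))"
        by auto
      have J: "l \<in> J" "J \<subseteq> L" "r \<in> S" "S \<subseteq> R" "E \<inter> (J \<times> S) = {(l, r)}"
        using 1 by (simp_all add: P_def)
      note g = hypertrees_glue[OF fin J 1(2,3), folded b]
      have "\<not> sum b S < card (nb ?E L S)" using g(2,3) by simp
      then have "b \<notin> hypertrees ?E L R" using J unfolding hypertrees_def by blast
      then show "b \<in> hypertrees E L R - hypertrees ?E L R" using g(1) by blast
    next
      fix b assume "b \<in> hypertrees E L R - hypertrees ?E L R"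
      then obtain J S b1 b2 where "l \<in> J" "J \<subseteq> L" "r \<in> S" "S \<subseteq> R" "E \<inter> (J \<times> S) = {(l, r)}"
        "b1 \<in> hypertrees E (L - J) S" "b2 \<in> hypertrees E J (R - S)"
        "b = (\<lambda>x. b1 x + b2 x + of_bool (x = r))"
        using hypertrees_split[OF fin l r e npend] by blast
      then show "b \<in> ?f ` Sigma P ?H"
        by (intro image_eqI[of _ _ "((J, S), b1, b2)"]) (auto simp: P_def)
    qed
  qed
  then have "card (hypertrees E L R - hypertrees ?E L R) = card (Sigma P ?H)"
    by (simp add: bij_betw_same_card)
  also have "\<dots> = (\<Sum>p\<in>P. card (?H p))"
    using finP fin by (intro card_SigmaI) (auto simp: P_def intro!: finite_hypertrees finite_subset[OF _ fin(1)] finite_subset[OF _ fin(2)])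
  also have "\<dots> = (\<Sum>(J, S)\<in>P. card (hypertrees E (L - J) S) * card (hypertrees E J (R - S)))"
    by (simp add: card_cartesian_product case_prod_beta)
  finally have "card (hypertrees E L R - hypertrees ?E L R) =
    (\<Sum>(J, S)\<in>P. card (hypertrees E (L - J) S) * card (hypertrees E J (R - S)))" .
  moreover have "card (hypertrees E L R) =
      card (hypertrees ?E L R) + card (hypertrees E L R - hypertrees ?E L R)"
    using card_Un_disjoint[of "hypertrees ?E L R" "hypertrees E L R - hypertrees ?E L R"] fin sub
    by (simp add: Un_absorb1)
  ultimately show ?thesis by simp
qed

section \<open>Isolated and pendant vertices\<close>

lemma hypertrees_isolated:
  fixes E :: "('a \<times> 'b) set"
  assumes "finite L" "finite R" "L \<noteq> {}" "r \<in> R" "nb E L {r} = {}"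
  shows "hypertrees E L R = {}" and "hypertrees (E\<inverse>) R L = {}"
proof -
  have "\<not> sum b {r} < card (nb E L {r})" for b :: "'b \<Rightarrow> nat" using assms by simp
  then show "hypertrees E L R = {}" using assms hypertreesD(2)[of _ E L R "{r}"] by blast
  \<comment> \<open>In the transpose the inequality for all of \<open>L\<close> would need every
    vertex of \<open>R\<close> as a neighbour, but \<open>r\<close> is never reached.\<close>
  have "nb (E\<inverse>) R L \<subseteq> R - {r}" using assms by (auto simp: nb_def)
  then have "card (nb (E\<inverse>) R L) \<le> card (R - {r})" using assms by (intro card_mono) auto
  also have "\<dots> < card R" using assms by (intro card_Diff1_less)
  finally have "\<not> (sum a L < card (nb (E\<inverse>) R L) \<and> Suc (sum a L) = card R)" for a :: "'a \<Rightarrow> nat"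
    by simp
  then show "hypertrees (E\<inverse>) R L = {}"
    using assms hypertreesD(2)[of _ "E\<inverse>" R L L] hypertreesD(3)[of _ "E\<inverse>" R L] by blast
qed

text \<open>The inequality for \<open>{r}\<close> forces the value 0: a vertex with one neighbour is
  a leaf of every spanning tree.\<close>

lemma hypertrees_pendant_right:
  assumes fin: "finite L" "finite R" and r: "r \<in> R" "nb E L {r} = {l}" and ne: "R - {r} \<noteq> {}"
  shows "hypertrees E L R = hypertrees E L (R - {r})"
proof (intro equalityI subsetI)
  fix b assume b: "b \<in> hypertrees E L R"
  have "sum b {r} < card (nb E L {r})" using r by (intro hypertreesD(2)[OF b]) auto
  then have br: "b r = 0" using r by simp
  then have "sum b R = sum b (R - {r})" using sum.remove[of R r b] r fin by simp
  then show "b \<in> hypertrees E L (R - {r})" using b br unfolding hypertrees_def by auto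
next
  fix b assume b: "b \<in> hypertrees E L (R - {r})"
  have br: "b r = 0" using b by (simp add: hypertrees_def)
  have rm: "sum b S = sum b (S - {r})" if "finite S" for S
    using that br sum.remove[of S r b] by (cases "r \<in> S") simp_all
  show "b \<in> hypertrees E L R"
  proof (rule hypertreesI)
    fix S assume S: "S \<subseteq> R" "S \<noteq> {}"
    have fS: "finite S" using S fin finite_subset by blast
    show "sum b S < card (nb E L S)"
    proof (cases "S - {r} = {}")
      case True
      then have "S = {r}" using S by blast
      then show ?thesis using r br by simp
    next
      case False
      have "sum b S = sum b (S - {r})" by (rule rm[OF fS])
      also have "\<dots> < card (nb E L (S - {r}))"
        using S False by (intro hypertreesD(2)[OF b]) auto
      also have "\<dots> \<le> card (nb E L S)" using fin by (intro card_mono nb_mono) auto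
      finally show ?thesis .
    qed
  qed (use b rm[OF fin(2)] in \<open>auto simp: hypertrees_def\<close>)
qed

text \<open>The leaf \<open>l\<close> contributes exactly one to the degree of its neighbour
  \<open>r\<close> in each spanning tree, so adding 1 at \<open>r\<close> is a bijection.\<close>

lemma card_hypertrees_pendant_left:
  assumes fin: "finite L" "finite R" and l: "l \<in> L" "nb (E\<inverse>) R {l} = {r}" and ne: "L - {l} \<noteq> {}"
  shows "card (hypertrees E L R) = card (hypertrees E (L - {l}) R)"
proof -
  have r: "r \<in> R" "(l, r) \<in> E" and only: "\<And>s. s \<in> R \<Longrightarrow> (l, s) \<in> E \<longleftrightarrow> s = r"
    using l(2) unfolding nb_def by blast+
  have cnb: "card (nb E L S) = card (nb E (L - {l}) S) + of_bool (r \<in> S)" if "S \<subseteq> R" for S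
  proof (cases "r \<in> S")
    case True
    then have "nb E L S = insert l (nb E (L - {l}) S)" using l(1) r by (auto simp: nb_def)
    moreover have "l \<notin> nb E (L - {l}) S" by (auto simp: nb_def)
    ultimately show ?thesis using True fin by simp
  next
    case False
    then have "nb E L S = nb E (L - {l}) S" using only that unfolding nb_def by blast
    then show ?thesis using False by simp
  qed
  have cL: "card L = Suc (card (L - {l}))" using card_Suc_Diff1[of L l] l fin by simp
  have upd: "sum (\<lambda>x. b x + of_bool (x = r)) S = sum b S + of_bool (r \<in> S)" if "S \<subseteq> R" for b :: "'b \<Rightarrow> nat" and S
    using finite_subset[OF that fin(2)] by (simp add: sum.distrib of_bool_def)
  have dec: "b = (\<lambda>x. (b x - of_bool (x = r)) + of_bool (x = r))" if "b \<in> hypertrees E L R" for b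
  proof -
    \<comment> \<open>Otherwise \<open>R - {r}\<close> would carry the whole sum
      \<open>card (L - {l})\<close>, while its neighbours all lie in \<open>L - {l}\<close> and must
      be strictly more numerous than this sum.\<close>
    have "b r \<noteq> 0"
    proof
      assume "b r = 0"
      then have *: "sum b R = sum b (R - {r})" using sum.remove[of R r b] fin r by simp
      show False
      proof (cases "R - {r} = {}")
        case True
        then have "sum b R = 0" using * by (simp only: sum.empty)
        then have "card (L - {l}) = 0" using that cL unfolding hypertrees_def by simp
        then show False using ne fin by simp
      next
        case False
        then have "sum b (R - {r}) < card (nb E L (R - {r}))"
          using False by (intro hypertreesD(2)[OF that]) auto
        also have "\<dots> = card (nb E (L - {l}) (R - {r}))" using cnb[of "R - {r}"] by auto
        also have "\<dots> \<le> card (L - {l})" using fin by (intro card_mono nb_subset) auto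
        finally show False using * cL that unfolding hypertrees_def by simp
      qed
    qed
    then show ?thesis by (auto simp: fun_eq_iff)
  qed
  have "bij_betw (\<lambda>b x. b x + of_bool (x = r)) (hypertrees E (L - {l}) R) (hypertrees E L R)"
    unfolding bij_betw_def
  proof
    show "inj_on (\<lambda>b x. b x + of_bool (x = r) :: nat) (hypertrees E (L - {l}) R)"
      by (rule inj_onI) (auto simp: fun_eq_iff)
    have iff: "(\<lambda>x. b x + of_bool (x = r)) \<in> hypertrees E L R \<longleftrightarrow> b \<in> hypertrees E (L - {l}) R" for b
    proof -
      have "(\<forall>s. s \<notin> R \<longrightarrow> b s + of_bool (s = r) = 0) \<longleftrightarrow> (\<forall>s. s \<notin> R \<longrightarrow> b s = 0)"
        using r by auto
      moreover have "(\<forall>S. S \<subseteq> R \<and> S \<noteq> {} \<longrightarrow> (\<Sum>x\<in>S. b x + of_bool (x = r)) < card (nb E L S)) \<longleftrightarrow>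
          (\<forall>S. S \<subseteq> R \<and> S \<noteq> {} \<longrightarrow> sum b S < card (nb E (L - {l}) S))"
        using upd[of _ b] cnb by (intro iff_allI imp_cong refl) simp
      moreover have "Suc (\<Sum>x\<in>R. b x + of_bool (x = r)) = card L \<longleftrightarrow> Suc (sum b R) = card (L - {l})"
        using upd[of R b] cL r by simp
      ultimately show ?thesis unfolding hypertrees_def by simp
    qed
    show "(\<lambda>b x. b x + of_bool (x = r)) ` hypertrees E (L - {l}) R = hypertrees E L R"
    proof (intro equalityI subsetI)
      fix b assume b: "b \<in> hypertrees E L R"
      then have "(\<lambda>x. b x - of_bool (x = r)) \<in> hypertrees E (L - {l}) R"
        using dec[OF b] iff[of "\<lambda>x. b x - of_bool (x = r)"] by simp
      then show "b \<in> (\<lambda>b x. b x + of_bool (x = r)) ` hypertrees E (L - {l}) R"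
        by (rule image_eqI[where f = "\<lambda>b x. b x + of_bool (x = r)", OF dec[OF b]])
    qed (use iff in auto)
  qed
  then show ?thesis by (simp add: bij_betw_same_card)
qed

lemma hypertrees_single_edge:
  assumes "(l, r) \<in> E"
  shows "hypertrees E {l} {r} = {\<lambda>_. 0}"
proof -
  have nb: "nb E {l} {r} = {l}" using assms by (auto simp: nb_def)
  have "b \<in> hypertrees E {l} {r} \<longleftrightarrow> b = (\<lambda>_. 0)" for b
  proof
    assume b: "b \<in> hypertrees E {l} {r}"
    have "b s = 0" for s
      using hypertreesD(1)[OF b, of s] hypertreesD(3)[OF b] by (cases "s = r") auto
    then show "b = (\<lambda>_. 0)" by auto
  next
    assume "b = (\<lambda>_. 0)"
    then show "b \<in> hypertrees E {l} {r}"
      using nb by (intro hypertreesI) (auto simp: subset_singleton_iff)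
  qed
  then show ?thesis by blast
qed

text \<open>Induction on the number of edges inside \<open>L \<times> R\<close>. Isolated and
  pendant vertices are removed directly; otherwise the self-dual edge recursion reduces both sides
  to smaller graphs in the same way.\<close>

theorem card_hypertrees_converse:
  fixes E :: "('a \<times> 'b) set"
  assumes "finite L" "finite R" "L \<noteq> {}" "R \<noteq> {}"
  shows "card (hypertrees E L R) = card (hypertrees (E\<inverse>) R L)"
  using assms
proof (induction "card (E \<inter> L \<times> R)" arbitrary: E L R rule: less_induct)
  case less
  note fin = \<open>finite L\<close> \<open>finite R\<close> and ne = \<open>L \<noteq> {}\<close> \<open>R \<noteq> {}\<close>
  \<comment> \<open>A single edge \<open>e\<close> that is lost witnesses the decrease.\<close>
  have IH: "card (hypertrees E' L' R') = card (hypertrees (E'\<inverse>) R' L')"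
    if "E' \<inter> L' \<times> R' \<subseteq> E \<inter> L \<times> R" "e \<in> E \<inter> L \<times> R" "e \<notin> E' \<inter> L' \<times> R'" "finite L'" "finite R'" "L' \<noteq> {}" "R' \<noteq> {}"
    for E' L' R' e
  proof (rule less.hyps)
    show "card (E' \<inter> L' \<times> R') < card (E \<inter> L \<times> R)"
      using that fin by (intro psubset_card_mono) auto
  qed (use that in auto)
  \<comment> \<open>When no simpler shape occurs, some edge has a further neighbour at both ends.
    This keeps all pieces of the recursion nonempty.\<close>
  consider (iso_r) r where "r \<in> R" "nb E L {r} = {}"
    | (iso_l) l where "l \<in> L" "nb (E\<inverse>) R {l} = {}"
    | (single) l r where "L = {l}" "R = {r}" "(l, r) \<in> E"
    | (pend_r) l r where "r \<in> R" "nb E L {r} = {l}" "R - {r} \<noteq> {}"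
    | (pend_l) l r where "l \<in> L" "nb (E\<inverse>) R {l} = {r}" "L - {l} \<noteq> {}"
    | (edge) l r where "l \<in> L" "r \<in> R" "(l, r) \<in> E" "\<exists>i\<in>L - {l}. (i, r) \<in> E" "\<exists>s\<in>R - {r}. (l, s) \<in> E"
  proof -
    obtain r where r: "r \<in> R" using ne by blast
    show thesis
    proof (cases "nb E L {r} = {}")
      case True
      then show thesis using iso_r r by blast
    next
      case False
      then obtain l where l: "l \<in> L" "(l, r) \<in> E" by (auto simp: nb_def)
      show thesis
      proof (cases "\<exists>i\<in>L - {l}. (i, r) \<in> E")
        case False
        then have r1: "nb E L {r} = {l}" using l by (auto simp: nb_def)
        show thesis
        proof (cases "R - {r} = {}")
          case True
          then have R: "R = {r}" using r by blast
          show thesis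
          proof (cases "L = {l}")
            case True
            then show thesis using single R l by blast
          next
            case False
            then obtain i where "i \<in> L" "i \<noteq> l" using l by blast
            then have "nb (E\<inverse>) R {i} = {}" using r1 R by (auto simp: nb_def)
            then show thesis using iso_l \<open>i \<in> L\<close> by blast
          qed
        qed (use pend_r r r1 in blast)
      next
        case nl: True
        show thesis
        proof (cases "\<exists>s\<in>R - {r}. (l, s) \<in> E")
          case True
          then show thesis using edge l r nl by blast
        next
          case False
          then have "nb (E\<inverse>) R {l} = {r}" using l r by (auto simp: nb_def)
          then show thesis using pend_l l nl by blast
        qed
      qed
    qed
  qed
  then show ?case
  proof cases
    case iso_r
    then show ?thesis using hypertrees_isolated[OF fin ne(1)] by simp
  next
    case iso_l
    then show ?thesis using hypertrees_isolated[OF fin(2,1) ne(2), of l "E\<inverse>"] by simp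
  next
    case single
    then show ?thesis using hypertrees_single_edge[of l r E] hypertrees_single_edge[of r l "E\<inverse>"] by simp
  next
    case pend_r
    have "l \<in> L" "(l, r) \<in> E" using pend_r by (auto simp: nb_def set_eq_iff)
    have "card (hypertrees E L R) = card (hypertrees E L (R - {r}))"
      using hypertrees_pendant_right[OF fin] pend_r by metis
    also have "\<dots> = card (hypertrees (E\<inverse>) (R - {r}) L)"
      using fin ne pend_r \<open>l \<in> L\<close> \<open>(l, r) \<in> E\<close> by (intro IH[of _ _ _ "(l, r)"]) auto
    also have "\<dots> = card (hypertrees (E\<inverse>) R L)"
      using card_hypertrees_pendant_left[OF fin(2,1), of r "E\<inverse>" l] pend_r by simp
    finally show ?thesis .
  next
    case pend_l
    have "r \<in> R" "(l, r) \<in> E" using pend_l by (auto simp: nb_def set_eq_iff)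
    have "card (hypertrees E L R) = card (hypertrees E (L - {l}) R)"
      using card_hypertrees_pendant_left[OF fin] pend_l by metis
    also have "\<dots> = card (hypertrees (E\<inverse>) R (L - {l}))"
      using fin ne pend_l \<open>r \<in> R\<close> \<open>(l, r) \<in> E\<close> by (intro IH[of _ _ _ "(l, r)"]) auto
    also have "\<dots> = card (hypertrees (E\<inverse>) R L)"
      using hypertrees_pendant_right[OF fin(2,1), of l "E\<inverse>" r] pend_l by simp
    finally show ?thesis .
  next
    case edge
    let ?E = "E - {(l, r)}"
    let ?P = "{(J, S). l \<in> J \<and> J \<subseteq> L \<and> r \<in> S \<and> S \<subseteq> R \<and> E \<inter> J \<times> S = {(l, r)}}"
    let ?Q = "{(S, J). r \<in> S \<and> S \<subseteq> R \<and> l \<in> J \<and> J \<subseteq> L \<and> E\<inverse> \<inter> S \<times> J = {(r, l)}}"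
    \<comment> \<open>Transposition exchanges the roles of the two pieces, hence the order of the
      factors.\<close>
    have summand: "card (hypertrees E (L - J) S) * card (hypertrees E J (R - S)) =
        card (hypertrees (E\<inverse>) (R - S) J) * card (hypertrees (E\<inverse>) S (L - J))"
      if "(J, S) \<in> ?P" for J S
    proof -
      have J: "l \<in> J" "J \<subseteq> L" "r \<in> S" "S \<subseteq> R" "E \<inter> J \<times> S = {(l, r)}" using that by simp_all
      have fJ: "finite J" "finite S" using J fin finite_subset by blast+
      \<comment> \<open>If \<open>J\<close> were all of \<open>L\<close>, the second neighbour of
        \<open>r\<close> would give a second edge between \<open>J\<close> and
        \<open>S\<close>.\<close>
      have "L - J \<noteq> {}"
      proof
        assume "L - J = {}"
        then have "J = L" using J by blast
        then show False using edge(4) J by blast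
      qed
      moreover have "R - S \<noteq> {}"
      proof
        assume "R - S = {}"
        then have "S = R" using J by blast
        then show False using edge(5) J by blast
      qed
      \<comment> \<open>The edge \<open>(l, r)\<close> runs from \<open>J\<close> to
        \<open>S\<close> and so belongs to neither piece.\<close>
      ultimately have "card (hypertrees E (L - J) S) = card (hypertrees (E\<inverse>) S (L - J))"
        "card (hypertrees E J (R - S)) = card (hypertrees (E\<inverse>) (R - S) J)"
        using fJ fin J edge by (intro IH[of _ _ _ "(l, r)"]; blast)+
      then show ?thesis by simp
    qed
    have "card (hypertrees E L R) = card (hypertrees ?E L R) +
        (\<Sum>(J, S)\<in>?P. card (hypertrees E (L - J) S) * card (hypertrees E J (R - S)))"
      by (rule card_hypertrees_delete_edge) (use fin edge in auto)
    also have "card (hypertrees ?E L R) = card (hypertrees (?E\<inverse>) R L)"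
      using fin ne edge by (intro IH[of _ _ _ "(l, r)"]) auto
    also have "?E\<inverse> = E\<inverse> - {(r, l)}" by auto
    also have "(\<Sum>(J, S)\<in>?P. card (hypertrees E (L - J) S) * card (hypertrees E J (R - S))) =
        (\<Sum>(S, J)\<in>?Q. card (hypertrees (E\<inverse>) (R - S) J) * card (hypertrees (E\<inverse>) S (L - J)))"
    proof (rule sum.reindex_bij_witness[of _ prod.swap prod.swap])
      fix p assume p: "p \<in> ?P"
      obtain J S where pe: "p = (J, S)" by (cases p)
      show "prod.swap p \<in> ?Q" using p by (auto simp: pe)
      show "(case prod.swap p of (S, J) \<Rightarrow> card (hypertrees (E\<inverse>) (R - S) J) * card (hypertrees (E\<inverse>) S (L - J))) =
          (case p of (J, S) \<Rightarrow> card (hypertrees E (L - J) S) * card (hypertrees E J (R - S)))"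
        using summand[of J S] p by (simp add: pe)
    qed auto
    also have "card (hypertrees (E\<inverse> - {(r, l)}) R L) + \<dots> = card (hypertrees (E\<inverse>) R L)"
      by (rule card_hypertrees_delete_edge[symmetric]) (use fin edge in auto)
    finally show ?thesis .
  qed
qed

section \<open>Draconian sequences\<close>

text \<open>The values sit on right vertices, as for hypertrees; the sequences on left vertices are
  obtained from \<open>E\<inverse>\<close>. Functions vanish outside \<open>R\<close>, which allows
  sums over larger sets.\<close>

definition draconians :: "('a \<times> 'b) set \<Rightarrow> 'a set \<Rightarrow> 'b set \<Rightarrow> ('b \<Rightarrow> nat) set" where
  "draconians E L R = {b. (\<forall>r. r \<notin> R \<longrightarrow> b r = 0) \<and> (\<forall>S. S \<subseteq> R \<longrightarrow> sum b S \<le> card (nb E L S))}"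

definition strict_draconians :: "('a \<times> 'b) set \<Rightarrow> 'a set \<Rightarrow> 'b set \<Rightarrow> ('b \<Rightarrow> nat) set" where
  "strict_draconians E L R = {b. (\<forall>r. r \<notin> R \<longrightarrow> b r = 0) \<and>
     (\<forall>S. S \<subseteq> R \<and> S \<noteq> {} \<longrightarrow> sum b S < card (nb E L S))}"

lemma draconiansI:
  assumes "\<And>r. r \<notin> R \<Longrightarrow> b r = 0" "\<And>S. S \<subseteq> R \<Longrightarrow> S \<noteq> {} \<Longrightarrow> sum b S \<le> card (nb E L S)"
  shows "b \<in> draconians E L R"
  unfolding draconians_def
proof (intro CollectI conjI allI impI)
  fix S assume "S \<subseteq> R"
  then show "sum b S \<le> card (nb E L S)" using assms(2)[of S] by (cases "S = {}") auto
qed (use assms(1) in auto)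

lemma draconiansD:
  assumes "b \<in> draconians E L R"
  shows "r \<notin> R \<Longrightarrow> b r = 0" and "S \<subseteq> R \<Longrightarrow> sum b S \<le> card (nb E L S)"
  using assms by (simp_all add: draconians_def)

lemma strict_draconiansI:
  assumes "\<And>r. r \<notin> R \<Longrightarrow> b r = 0" "\<And>S. S \<subseteq> R \<Longrightarrow> S \<noteq> {} \<Longrightarrow> sum b S < card (nb E L S)"
  shows "b \<in> strict_draconians E L R"
  using assms by (simp add: strict_draconians_def)

lemma strict_draconiansD:
  assumes "b \<in> strict_draconians E L R"
  shows "r \<notin> R \<Longrightarrow> b r = 0" and "S \<subseteq> R \<Longrightarrow> S \<noteq> {} \<Longrightarrow> sum b S < card (nb E L S)"
  using assms by (simp_all add: strict_draconians_def)

lemma finite_draconians [simp]: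
  assumes "finite L" "finite R"
  shows "finite (draconians E L R)"
proof (rule finite_subset[OF _ finite_bounded_supported[OF \<open>finite R\<close>, of "card L"]], clarsimp, intro conjI allI impI ballI)
  fix b r
  assume b: "b \<in> draconians E L R"
  show "r \<notin> R \<Longrightarrow> b r = 0" using b by (rule draconiansD)
  assume "r \<in> R"
  then have "b r \<le> card (nb E L {r})"
    using draconiansD(2)[OF b, of "{r}"] by simp
  also have "\<dots> \<le> card L" by (intro card_mono nb_subset assms)
  finally show "b r \<le> card L" .
qed

lemma strict_draconians_subset: "strict_draconians E L R \<subseteq> draconians E L R"
  by (intro subsetI draconiansI) (auto dest: strict_draconiansD intro: less_imp_le)

section \<open>Adjoining a vertex joined to everything\<close>

definition add_left :: "('a \<times> 'b) set \<Rightarrow> ('a option \<times> 'b) set" where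
  "add_left E = {(Some i, r) |i r. (i, r) \<in> E} \<union> {None} \<times> UNIV"

text \<open>This is how the added vertex \<open>None\<close> converts weak inequalities into strict
  ones.\<close>

lemma card_nb_add_left:
  assumes "finite L" "S \<noteq> {}"
  shows "card (nb (add_left E) (insert None (Some ` L)) S) = Suc (card (nb E L S))"
proof -
  have "nb (add_left E) (insert None (Some ` L)) S = insert None (Some ` nb E L S)"
    using assms(2) unfolding nb_def add_left_def by auto
  then show ?thesis using assms(1) by (simp add: card_image)
qed

lemma nb_add_left_converse:
  "nb ((add_left E)\<inverse>) R J = (if None \<in> J then R else nb (E\<inverse>) R (Some -` J))"
proof (cases "None \<in> J")
  case False
  have "(\<exists>j\<in>J. (r, j) \<in> (add_left E)\<inverse>) \<longleftrightarrow> (\<exists>i\<in>Some -` J. (r, i) \<in> E\<inverse>)" for r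
  proof
    assume "\<exists>j\<in>J. (r, j) \<in> (add_left E)\<inverse>"
    then obtain j where "j \<in> J" "(j, r) \<in> add_left E" by auto
    then show "\<exists>i\<in>Some -` J. (r, i) \<in> E\<inverse>" using False by (cases j) (auto simp: add_left_def)
  qed (auto simp: add_left_def)
  then show ?thesis using False by (simp add: nb_def)
qed (auto simp: nb_def add_left_def)

lemma sum_option:
  fixes a :: "'a option \<Rightarrow> nat"
  assumes "finite J"
  shows "sum a J = of_bool (None \<in> J) * a None + (\<Sum>i\<in>Some -` J. a (Some i))"
proof -
  have J: "J - {None} = Some ` (Some -` J)"
    by (auto simp: image_iff vimage_def) (metis not_None_eq)
  have "sum a J = of_bool (None \<in> J) * a None + sum a (J - {None})"
    using assms sum.remove[of J None a] by (cases "None \<in> J") auto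
  also have "sum a (J - {None}) = (\<Sum>i\<in>Some -` J. a (Some i))"
    unfolding J by (subst sum.reindex) auto
  finally show ?thesis .
qed

text \<open>With a left vertex \<open>None\<close> joined to everything, the tight sequences become
  hypertrees. In the transposed graph the value at \<open>None\<close> is determined by the total,
  and the inequalities for sets without \<open>None\<close> are those of
  \<open>strict_draconians\<close>; sets containing \<open>None\<close> have all of \<open>R\<close>
  as neighbours.\<close>

theorem card_tight_draconians:
  fixes E :: "('a \<times> 'b) set"
  assumes fin: "finite L" "finite R"
  shows "card {b \<in> draconians E L R. sum b R = card L} = card (strict_draconians (E\<inverse>) R L)"
proof (cases "R = {}")
  \<comment> \<open>The duality asks for nonempty sides. Without right vertices both counts are 1 if
    \<open>L\<close> is empty and 0 otherwise.\<close>
  case True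
  have "\<not> sum a {l} < card (nb (E\<inverse>) {} {l})" for a :: "'a \<Rightarrow> nat" and l
    by (simp add: nb_def)
  then have "strict_draconians (E\<inverse>) R L = (if L = {} then {\<lambda>_. 0} else {})"
    unfolding True strict_draconians_def by (auto simp: fun_eq_iff)
  moreover have "{b \<in> draconians E L R. sum b R = card L} = (if L = {} then {\<lambda>_. 0} else {})"
    unfolding True draconians_def using fin by (auto simp: fun_eq_iff)
  ultimately show ?thesis by simp
next
  case ne: False
  let ?E = "add_left E" and ?L = "insert None (Some ` L)"
  have cL: "card ?L = Suc (card L)" using fin by (simp add: card_image)
  have "{b \<in> draconians E L R. sum b R = card L} = hypertrees ?E ?L R"
  proof (intro equalityI subsetI)
    fix b assume b: "b \<in> {b \<in> draconians E L R. sum b R = card L}"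
    then have bD: "b \<in> draconians E L R" by simp
    show "b \<in> hypertrees ?E ?L R"
    proof (rule hypertreesI)
      fix S assume "S \<subseteq> R" "S \<noteq> {}"
      then show "sum b S < card (nb ?E ?L S)"
        using draconiansD(2)[OF bD, of S] card_nb_add_left[OF fin(1), of S E] by simp
    qed (use b cL draconiansD(1)[OF bD] in auto)
  next
    fix b assume b: "b \<in> hypertrees ?E ?L R"
    have "b \<in> draconians E L R"
    proof (rule draconiansI)
      fix S assume "S \<subseteq> R" "S \<noteq> {}"
      then show "sum b S \<le> card (nb E L S)"
        using hypertreesD(2)[OF b, of S] card_nb_add_left[OF fin(1), of S E] by simp
    qed (use hypertreesD(1)[OF b] in auto)
    then show "b \<in> {b \<in> draconians E L R. sum b R = card L}"
      using hypertreesD(3)[OF b] cL by simp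
  qed
  then have "card {b \<in> draconians E L R. sum b R = card L} = card (hypertrees ?E ?L R)" by simp
  also have "\<dots> = card (hypertrees (?E\<inverse>) R ?L)"
    using fin ne by (intro card_hypertrees_converse) auto
  also have "\<dots> = card (strict_draconians (E\<inverse>) R L)"
  proof (rule bij_betw_same_card)
    have vS: "Some -` (Some ` J) = J" for J :: "'a set" by auto
    have vL: "Some -` ?L = L" by auto
    show "bij_betw (\<lambda>a i. a (Some i)) (hypertrees (?E\<inverse>) R ?L) (strict_draconians (E\<inverse>) R L)"
    \<comment> \<open>The value at \<open>None\<close> is what the hypertree total
      \<open>card R - 1\<close> leaves over.\<close>
    proof (rule bij_betwI[where g = "\<lambda>a. case_option (card R - 1 - sum a L) a"])
      show "(\<lambda>a i. a (Some i)) \<in> hypertrees (?E\<inverse>) R ?L \<rightarrow> strict_draconians (E\<inverse>) R L"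
      proof
        fix a assume a: "a \<in> hypertrees (?E\<inverse>) R ?L"
        show "(\<lambda>i. a (Some i)) \<in> strict_draconians (E\<inverse>) R L"
        proof (rule strict_draconiansI)
          fix J assume J: "J \<subseteq> L" "J \<noteq> {}"
          have "finite (Some ` J)" using J fin finite_subset by blast
          then show "(\<Sum>i\<in>J. a (Some i)) < card (nb (E\<inverse>) R J)"
            using hypertreesD(2)[OF a, of "Some ` J"] J sum_option[of "Some ` J" a] vS[of J]
            by (auto simp: nb_add_left_converse)
        qed (use hypertreesD(1)[OF a] in auto)
      qed
    next
      show "(\<lambda>a. case_option (card R - 1 - sum a L) a) \<in> strict_draconians (E\<inverse>) R L \<rightarrow> hypertrees (?E\<inverse>) R ?L"
      proof
        fix a assume a: "a \<in> strict_draconians (E\<inverse>) R L"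
        let ?a = "case_option (card R - 1 - sum a L) a"
        \<comment> \<open>Makes the truncated subtraction in \<open>?a\<close> exact; for empty
          \<open>L\<close> it rests on \<open>R\<close> being nonempty.\<close>
        have lt: "sum a L < card R"
        proof (cases "L = {}")
          case True
          then show ?thesis using ne fin by (simp add: card_gt_0_iff)
        next
          case False
          then have "sum a L < card (nb (E\<inverse>) R L)" by (intro strict_draconiansD(2)[OF a]) auto
          also have "\<dots> \<le> card R" using fin by (intro card_mono nb_subset) auto
          finally show ?thesis .
        qed
        show "?a \<in> hypertrees (?E\<inverse>) R ?L"
        proof (rule hypertreesI)
          fix r assume r: "r \<notin> ?L"
          show "?a r = 0" using r strict_draconiansD(1)[OF a] by (cases r) auto
        next
          fix J assume J: "J \<subseteq> ?L" "J \<noteq> {}"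
          have fJ: "finite J" using J fin finite_subset by blast
          have sub: "Some -` J \<subseteq> L" using J by auto
          show "sum ?a J < card (nb (?E\<inverse>) R J)"
          proof (cases "None \<in> J")
            case True
            have "sum a (Some -` J) \<le> sum a L" using fin sub by (intro sum_mono2) auto
            then show ?thesis using sum_option[OF fJ, of ?a] True lt by (simp add: nb_add_left_converse)
          next
            case False
            then have "Some -` J \<noteq> {}" using J by auto
            then show ?thesis using strict_draconiansD(2)[OF a sub] sum_option[OF fJ, of ?a] False
              by (simp add: nb_add_left_converse)
          qed
        next
          show "Suc (sum ?a ?L) = card R" using fin lt sum_option[of ?L ?a] vL by simp
        qed
      qed
    next
      fix a assume a: "a \<in> hypertrees (?E\<inverse>) R ?L"
      have "Suc (a None + (\<Sum>i\<in>L. a (Some i))) = card R"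
        using hypertreesD(3)[OF a] fin sum_option[of ?L a] vL by simp
      then show "case_option (card R - 1 - (\<Sum>i\<in>L. a (Some i))) (\<lambda>i. a (Some i)) = a"
        by (auto simp: fun_eq_iff split: option.splits)
    qed simp
  qed
  finally show ?thesis .
qed

text \<open>A right vertex joined to everything absorbs the slack \<open>card L - sum b R\<close>,
  so every draconian sequence becomes tight. After \<open>card_tight_draconians\<close> the same
  vertex turns the strict inequalities of the transpose back into weak ones.\<close>

theorem card_draconians_converse:
  fixes E :: "('a \<times> 'b) set"
  assumes fin: "finite L" "finite R"
  shows "card (draconians E L R) = card (draconians (E\<inverse>) R L)"
proof -
  \<comment> \<open>Transposing twice places the new vertex on the right.\<close>
  let ?E = "(add_left (E\<inverse>))\<inverse>" and ?R = "insert None (Some ` R)"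
  have vS: "Some -` (Some ` S) = S" for S :: "'b set" by auto
  have vR: "Some -` ?R = R" by auto
  have sR: "sum b ?R = b None + (\<Sum>r\<in>R. b (Some r))" for b :: "'b option \<Rightarrow> nat"
    using fin sum_option[of ?R b] vR by simp
  have "card (draconians E L R) = card {b \<in> draconians ?E L ?R. sum b ?R = card L}"
  proof (rule bij_betw_same_card[symmetric])
    show "bij_betw (\<lambda>b r. b (Some r)) {b \<in> draconians ?E L ?R. sum b ?R = card L} (draconians E L R)"
    proof (rule bij_betwI[where g = "\<lambda>b. case_option (card L - sum b R) b"])
      show "(\<lambda>b r. b (Some r)) \<in> {b \<in> draconians ?E L ?R. sum b ?R = card L} \<rightarrow> draconians E L R"
      proof
        fix b assume "b \<in> {b \<in> draconians ?E L ?R. sum b ?R = card L}"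
        then have b: "b \<in> draconians ?E L ?R" by simp
        show "(\<lambda>r. b (Some r)) \<in> draconians E L R"
        proof (rule draconiansI)
          fix S assume S: "S \<subseteq> R"
          have "finite (Some ` S)" using S fin finite_subset by blast
          then show "(\<Sum>r\<in>S. b (Some r)) \<le> card (nb E L S)"
            using draconiansD(2)[OF b, of "Some ` S"] S sum_option[of "Some ` S" b] vS[of S]
            by (auto simp: nb_add_left_converse)
        qed (use draconiansD(1)[OF b] in auto)
      qed
    next
      show "(\<lambda>b. case_option (card L - sum b R) b) \<in> draconians E L R \<rightarrow> {b \<in> draconians ?E L ?R. sum b ?R = card L}"
      proof
        fix b assume b: "b \<in> draconians E L R"
        let ?b = "case_option (card L - sum b R) b"
        have "sum b R \<le> card (nb E L R)" by (intro draconiansD(2)[OF b]) auto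
        also have "\<dots> \<le> card L" using fin by (intro card_mono nb_subset) auto
        finally have le: "sum b R \<le> card L" .
        have "?b \<in> draconians ?E L ?R"
        proof (rule draconiansI)
          fix r assume r: "r \<notin> ?R"
          show "?b r = 0" using r draconiansD(1)[OF b] by (cases r) auto
        next
          fix S assume S: "S \<subseteq> ?R"
          have fS: "finite S" using S fin finite_subset by blast
          have sub: "Some -` S \<subseteq> R" using S by auto
          show "sum ?b S \<le> card (nb ?E L S)"
          proof (cases "None \<in> S")
            case True
            have "sum b (Some -` S) \<le> sum b R" using fin sub by (intro sum_mono2) auto
            then show ?thesis using sum_option[OF fS, of ?b] True le by (simp add: nb_add_left_converse)
          next
            case False
            then show ?thesis using draconiansD(2)[OF b sub] sum_option[OF fS, of ?b]
              by (simp add: nb_add_left_converse)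
          qed
        qed
        then show "?b \<in> {b \<in> draconians ?E L ?R. sum b ?R = card L}" using sR[of ?b] le by simp
      qed
    next
      fix b assume b: "b \<in> {b \<in> draconians ?E L ?R. sum b ?R = card L}"
      then have "b None + (\<Sum>r\<in>R. b (Some r)) = card L" using sR[of b] by simp
      then show "case_option (card L - (\<Sum>r\<in>R. b (Some r))) (\<lambda>r. b (Some r)) = b"
        by (auto simp: fun_eq_iff split: option.splits)
    qed simp
  qed
  also have "\<dots> = card (strict_draconians (?E\<inverse>) ?R L)"
    using fin by (intro card_tight_draconians) auto
  also have "strict_draconians (?E\<inverse>) ?R L = draconians (E\<inverse>) R L"
  proof (intro equalityI subsetI)
    fix a assume a: "a \<in> strict_draconians (?E\<inverse>) ?R L"
    show "a \<in> draconians (E\<inverse>) R L"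
    proof (rule draconiansI)
      fix J assume "J \<subseteq> L" "J \<noteq> {}"
      then show "sum a J \<le> card (nb (E\<inverse>) R J)"
        using strict_draconiansD(2)[OF a, of J] card_nb_add_left[OF fin(2), of J "E\<inverse>"] by simp
    qed (use strict_draconiansD(1)[OF a] in auto)
  next
    fix a assume a: "a \<in> draconians (E\<inverse>) R L"
    show "a \<in> strict_draconians (?E\<inverse>) ?R L"
    proof (rule strict_draconiansI)
      fix J assume "J \<subseteq> L" "J \<noteq> {}"
      then show "sum a J < card (nb (?E\<inverse>) ?R J)"
        using draconiansD(2)[OF a, of J] card_nb_add_left[OF fin(2), of J "E\<inverse>"] by simp
    qed (use draconiansD(1)[OF a] in auto)
  qed
  finally show ?thesis .
qed

section \<open>Perfectly matched sets\<close>

text \<open>Existence of a perfect matching between \<open>A\<close> and \<open>S\<close>, encoded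
  by Hall's condition; only these inequalities enter the argument, never a matching itself.\<close>

definition matchable :: "('a \<times> 'b) set \<Rightarrow> 'a set \<Rightarrow> 'b set \<Rightarrow> bool" where
  "matchable E A S \<longleftrightarrow> card A = card S \<and> (\<forall>T. T \<subseteq> S \<longrightarrow> card T \<le> card (nb E A T))"

text \<open>Hall's condition passes to the other side through complements: the vertices of
  \<open>S\<close> not adjacent to \<open>J\<close> have all their neighbours in
  \<open>A - J\<close>.\<close>

lemma matchable_converse_imp:
  assumes fin: "finite A" "finite S" and m: "matchable E A S"
  shows "matchable (E\<inverse>) S A"
  unfolding matchable_def
proof (intro conjI allI impI)
  fix J assume J: "J \<subseteq> A"
  let ?T = "S - nb (E\<inverse>) S J"
  have "nb E A ?T \<subseteq> A - J" by (auto simp: nb_def)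
  then have "card (nb E A ?T) \<le> card (A - J)" using fin by (intro card_mono) auto
  moreover have "card ?T \<le> card (nb E A ?T)" using m unfolding matchable_def by blast
  moreover have "card ?T = card S - card (nb (E\<inverse>) S J)"
    using fin by (simp add: card_Diff_subset nb_subset)
  moreover have "card (A - J) = card A - card J"
    using J fin finite_subset by (intro card_Diff_subset) auto
  moreover have "card J \<le> card A" "card A = card S"
    using card_mono[OF fin(1) J] m by (simp_all add: matchable_def)
  ultimately show "card J \<le> card (nb (E\<inverse>) S J)" by linarith
qed (use m in \<open>simp add: matchable_def\<close>)

lemma matchable_converse:
  assumes "finite A" "finite S"
  shows "matchable (E\<inverse>) S A \<longleftrightarrow> matchable E A S"
  using matchable_converse_imp[OF assms, of E] matchable_converse_imp[OF assms(2,1), of "E\<inverse>"] by auto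

section \<open>Draconian sequences with prescribed support\<close>

definition positives :: "('a \<times> 'b) set \<Rightarrow> 'a set \<Rightarrow> 'b set \<Rightarrow> ('b \<Rightarrow> nat) set" where
  "positives E A S = {b \<in> draconians E A S. \<forall>r\<in>S. 0 < b r}"

lemma draconians_support:
  assumes fin: "finite A" "finite S" and T: "T \<subseteq> S"
  shows "{b \<in> draconians E A S. {r \<in> S. 0 < b r} = T} = positives E A T"
proof (intro equalityI subsetI)
  fix b assume "b \<in> {b \<in> draconians E A S. {r \<in> S. 0 < b r} = T}"
  then have b: "b \<in> draconians E A S" and supp: "{r \<in> S. 0 < b r} = T" by auto
  have "b \<in> draconians E A T"
  proof (rule draconiansI)
    fix r assume "r \<notin> T"
    then show "b r = 0" using supp draconiansD(1)[OF b, of r] by (cases "r \<in> S") auto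
  next
    fix U assume "U \<subseteq> T"
    then show "sum b U \<le> card (nb E A U)" using assms by (intro draconiansD(2)[OF b]) auto
  qed
  then show "b \<in> positives E A T" using supp by (auto simp: positives_def)
next
  fix b assume "b \<in> positives E A T"
  then have b: "b \<in> draconians E A T" and pos: "\<And>r. r \<in> T \<Longrightarrow> 0 < b r" by (auto simp: positives_def)
  have "b \<in> draconians E A S"
  proof (rule draconiansI)
    fix r assume "r \<notin> S"
    then show "b r = 0" using assms draconiansD(1)[OF b] by blast
  next
    fix U assume U: "U \<subseteq> S"
    then have fU: "finite U" using fin finite_subset by blast
    have "sum b U = sum b (U \<inter> T)"
      using fU draconiansD(1)[OF b] by (intro sum_restrict_support) auto
    also have "\<dots> \<le> card (nb E A (U \<inter> T))" by (intro draconiansD(2)[OF b]) auto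
    also have "\<dots> \<le> card (nb E A U)"
      using fin by (intro card_mono nb_mono) auto
    finally show "sum b U \<le> card (nb E A U)" .
  qed
  moreover have "{r \<in> S. 0 < b r} = T"
  proof (intro equalityI subsetI)
    fix r assume "r \<in> {r \<in> S. 0 < b r}"
    then show "r \<in> T" using draconiansD(1)[OF b, of r] by (cases "r \<in> T") auto
  qed (use T pos in auto)
  ultimately show "b \<in> {b \<in> draconians E A S. {r \<in> S. 0 < b r} = T}" by simp
qed

lemma sum_draconians_by_support:
  assumes fin: "finite A" "finite S"
  shows "sum g (draconians E A S) = (\<Sum>T\<in>Pow S. sum g (positives E A T))"
proof -
  have "sum g (draconians E A S) =
      (\<Sum>T\<in>Pow S. sum g {b \<in> draconians E A S. {r \<in> S. 0 < b r} = T})"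
    using fin by (intro sum.group[symmetric]) auto
  also have "\<dots> = (\<Sum>T\<in>Pow S. sum g (positives E A T))"
    using fin by (intro sum.cong refl arg_cong2[where f = sum]) (auto simp: draconians_support)
  finally show ?thesis .
qed

lemma finite_positives [simp]:
  "finite A \<Longrightarrow> finite S \<Longrightarrow> finite (positives E A S)"
  by (simp add: positives_def)

lemma positives_card_bound:
  assumes fin: "finite A" "finite S" and b: "b \<in> positives E A S"
  shows "card S \<le> sum b S" "sum b S \<le> card A"
proof -
  have "(\<Sum>r\<in>S. 1) \<le> sum b S"
    using b by (intro sum_mono) (auto simp: positives_def Suc_le_eq)
  then show "card S \<le> sum b S" by simp
  have "sum b S \<le> card (nb E A S)"
    using b by (intro draconiansD(2)) (auto simp: positives_def)
  also have "\<dots> \<le> card A" using fin by (intro card_mono nb_subset) auto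
  finally show "sum b S \<le> card A" .
qed

lemma card_positives_gt:
  assumes "finite A" "finite S" "card A < card S"
  shows "card (positives E A S) = 0"
proof -
  have "positives E A S = {}"
    using positives_card_bound[OF assms(1,2)] assms(3) by (metis all_not_in_conv leD le_trans)
  then show ?thesis by simp
qed

lemma matchable_iff_draconian:
  "matchable E A S \<longleftrightarrow> card A = card S \<and> (\<lambda>r. of_bool (r \<in> S)) \<in> draconians E A S"
proof -
  have "(\<Sum>r\<in>T. of_bool (r \<in> S) :: nat) = card T" if "T \<subseteq> S" for T
  proof -
    have "(\<Sum>r\<in>T. of_bool (r \<in> S) :: nat) = (\<Sum>r\<in>T. 1)" using that by (intro sum.cong) auto
    then show ?thesis by simp
  qed
  then show ?thesis by (simp add: draconians_def matchable_def)
qed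

text \<open>The sum lies between \<open>card S\<close> and \<open>card A\<close>, so equality forces
  all values on \<open>S\<close> to be 1, and the inequalities become Hall's condition.\<close>

lemma card_positives_eq:
  assumes fin: "finite A" "finite S" and eq: "card A = card S"
  shows "card (positives E A S) = of_bool (matchable E A S)"
proof -
  let ?e = "\<lambda>r. of_bool (r \<in> S) :: nat"
  have "b = ?e" if b: "b \<in> positives E A S" for b
  proof -
    have "sum (\<lambda>r. b r - 1) S = sum b S - sum (\<lambda>_. 1) S"
      using b by (intro sum_subtractf_nat) (auto simp: positives_def Suc_le_eq)
    then have "sum (\<lambda>r. b r - 1) S = 0"
      using positives_card_bound[OF fin b] eq by simp
    then have "\<forall>r\<in>S. b r = 1"
      using fin b by (auto simp: positives_def Suc_le_eq intro: le_antisym)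
    moreover have "\<forall>r. r \<notin> S \<longrightarrow> b r = 0"
      using b by (auto simp: positives_def dest: draconiansD)
    ultimately show ?thesis by (auto simp: fun_eq_iff)
  qed
  moreover have "?e \<in> positives E A S \<longleftrightarrow> matchable E A S"
    using matchable_iff_draconian[of E A S] eq by (simp add: positives_def)
  ultimately have "positives E A S = (if matchable E A S then {?e} else {})" by auto
  then show ?thesis by simp
qed

lemma sum_Pow_remove_top:
  fixes f :: "'a set \<Rightarrow> nat"
  assumes "finite S"
  shows "sum f (Pow S) = f S + sum f (Pow S - {S})"
  using assms by (intro sum.remove) auto

text \<open>Both statements are proved together by induction on \<open>card A + card S\<close>.
  Splitting \<open>card_draconians_converse\<close> by supports leaves, after cancelling the terms
  known by induction, one relation between the two unknown counts; comparing \<open>card A\<close>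
  with \<open>card S\<close> determines one of them.\<close>

theorem card_positives:
  fixes E :: "('a \<times> 'b) set"
  assumes "finite A" "finite S"
  shows "card (positives E A S) = (\<Sum>B\<in>Pow A. of_bool (matchable E B S))"
    and "card (positives (E\<inverse>) S A) = (\<Sum>T\<in>Pow S. of_bool (matchable E A T))"
proof -
  let ?N = "\<lambda>A S. card (positives E A S)" and ?N' = "\<lambda>A S. card (positives (E\<inverse>) S A)"
  let ?m = "\<lambda>A S. of_bool (matchable E A S) :: nat"
  have "?N A S = (\<Sum>B\<in>Pow A. ?m B S) \<and> ?N' A S = (\<Sum>T\<in>Pow S. ?m A T)"
    using assms
  proof (induction "card A + card S" arbitrary: A S rule: less_induct)
    case less
    note fin = \<open>finite A\<close> \<open>finite S\<close>
    have fsub: "finite B" "finite T" if "B \<subseteq> A" "T \<subseteq> S" for B T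
      using that fin finite_subset by blast+
    have IH1: "?N A T = (\<Sum>B\<in>Pow A. ?m B T)" if "T \<in> Pow S - {S}" for T
      using that fin fsub[of A T] psubset_card_mono[of S T] by (intro less.hyps[THEN conjunct1]) auto
    have IH2: "?N' B S = (\<Sum>T\<in>Pow S. ?m B T)" if "B \<in> Pow A - {A}" for B
      using that fin fsub[of B S] psubset_card_mono[of A B] by (intro less.hyps[THEN conjunct2]) auto
    have "card (draconians E A S) = (\<Sum>T\<in>Pow S. ?N A T)"
      using sum_draconians_by_support[OF fin, of "\<lambda>_. 1 :: nat" E] by simp
    also have "\<dots> = ?N A S + (\<Sum>T\<in>Pow S - {S}. \<Sum>B\<in>Pow A. ?m B T)"
      using sum_Pow_remove_top[OF fin(2), of "?N A"] IH1 by simp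
    finally have 1: "card (draconians E A S) = ?N A S + (\<Sum>T\<in>Pow S - {S}. \<Sum>B\<in>Pow A. ?m B T)" .
    have "card (draconians (E\<inverse>) S A) = (\<Sum>B\<in>Pow A. ?N' B S)"
      using sum_draconians_by_support[OF fin(2,1), of "\<lambda>_. 1 :: nat" "E\<inverse>"] by simp
    also have "\<dots> = ?N' A S + (\<Sum>B\<in>Pow A - {A}. \<Sum>T\<in>Pow S. ?m B T)"
      using sum_Pow_remove_top[OF fin(1), of "\<lambda>B. ?N' B S"] IH2 by simp
    finally have 2: "card (draconians (E\<inverse>) S A) = ?N' A S + (\<Sum>B\<in>Pow A - {A}. \<Sum>T\<in>Pow S. ?m B T)" .
    \<comment> \<open>Both expansions count all matched pairs, except that one omits the pairs with
      \<open>T = S\<close> and the other those with \<open>B = A\<close>.\<close>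
    have "(\<Sum>T\<in>Pow S. \<Sum>B\<in>Pow A. ?m B T) = (\<Sum>B\<in>Pow A. \<Sum>T\<in>Pow S. ?m B T)"
      by (rule sum.swap)
    then have key: "?N A S + (\<Sum>T\<in>Pow S. ?m A T) = ?N' A S + (\<Sum>B\<in>Pow A. ?m B S)"
      using 1 2 card_draconians_converse[OF fin, of E]
        sum_Pow_remove_top[OF fin(2), of "\<lambda>T. \<Sum>B\<in>Pow A. ?m B T"]
        sum_Pow_remove_top[OF fin(1), of "\<lambda>B. \<Sum>T\<in>Pow S. ?m B T"] by linarith
    have le: "card B \<le> card A" "card T \<le> card S" if "B \<subseteq> A" "T \<subseteq> S" for B T
      using that fin by (auto intro: card_mono)
    consider "card A < card S" | "card S < card A" | "card A = card S" by linarith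
    then show ?case
    proof cases
      case 1
      then have "\<not> matchable E B S" if "B \<subseteq> A" for B
        using le(1)[OF that, of S] by (auto simp: matchable_def)
      then have "(\<Sum>B\<in>Pow A. ?m B S) = 0" by auto
      then show ?thesis using key card_positives_gt[OF fin 1, of E] by simp
    next
      case 2
      then have "\<not> matchable E A T" if "T \<subseteq> S" for T
        using le(2)[of A T] that by (auto simp: matchable_def)
      then have "(\<Sum>T\<in>Pow S. ?m A T) = 0" by auto
      then show ?thesis using key card_positives_gt[OF fin(2,1) 2, of "E\<inverse>"] by simp
    next
      case 3
      have "\<not> matchable E B S" if "B \<in> Pow A - {A}" for B
      proof -
        have "card B < card A" using that fin by (intro psubset_card_mono) auto
        then show ?thesis using 3 by (simp add: matchable_def)
      qed
      then have "(\<Sum>B\<in>Pow A - {A}. ?m B S) = 0" by auto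
      then have "(\<Sum>B\<in>Pow A. ?m B S) = ?m A S"
        using sum_Pow_remove_top[OF fin(1), of "\<lambda>B. ?m B S"] by simp
      moreover have "?N A S = ?m A S" by (rule card_positives_eq[OF fin 3])
      ultimately show ?thesis using key by simp
    qed
  qed
  then show "card (positives E A S) = (\<Sum>B\<in>Pow A. of_bool (matchable E B S))"
    and "card (positives (E\<inverse>) S A) = (\<Sum>T\<in>Pow S. of_bool (matchable E A T))" by auto
qed

text \<open>Grouped by support, either side is a sum over the matched pairs \<open>(A, S)\<close>.
  The weights \<open>2 ^ card S\<close> and \<open>2 ^ card A\<close> agree because matched sets
  have equal size.\<close>

theorem sum_two_power_draconians:
  fixes E :: "('a \<times> 'b) set"
  assumes fin: "finite L" "finite R"
  shows "(\<Sum>b\<in>draconians E L R. 2 ^ card {r \<in> R. 0 < b r} :: nat) =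
    (\<Sum>a\<in>draconians (E\<inverse>) R L. 2 ^ card {i \<in> L. 0 < a i})"
proof -
  have *: "(\<Sum>b\<in>draconians E L R. 2 ^ card {r \<in> R. 0 < b r} :: nat) =
    (\<Sum>S\<in>Pow R. 2 ^ card S * card (positives E L S))" if fin: "finite L" "finite R" for E :: "('x \<times> 'y) set" and L R
  proof -
    have "{r \<in> R. 0 < b r} = S" if "S \<subseteq> R" "b \<in> positives E L S" for b S
      using that draconians_support[OF fin that(1), of E] by auto
    then show ?thesis by (subst sum_draconians_by_support[OF fin]) (simp add: mult.commute)
  qed
  have "(\<Sum>b\<in>draconians E L R. 2 ^ card {r \<in> R. 0 < b r} :: nat) =
      (\<Sum>S\<in>Pow R. \<Sum>A\<in>Pow L. 2 ^ card S * of_bool (matchable E A S))"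
    unfolding *[OF fin] using fin
    by (intro sum.cong refl) (simp add: card_positives(1) finite_subset sum_distrib_left)
  also have "\<dots> = (\<Sum>A\<in>Pow L. \<Sum>S\<in>Pow R. 2 ^ card S * of_bool (matchable E A S))"
    by (rule sum.swap)
  also have "\<dots> = (\<Sum>A\<in>Pow L. \<Sum>S\<in>Pow R. 2 ^ card A * of_bool (matchable E A S))"
    by (intro sum.cong refl) (auto simp: matchable_def)
  also have "\<dots> = (\<Sum>a\<in>draconians (E\<inverse>) R L. 2 ^ card {i \<in> L. 0 < a i})"
    unfolding *[OF fin(2,1)] using fin
    by (intro sum.cong refl) (simp add: card_positives(2) finite_subset sum_distrib_left)
  finally show ?thesis .
qed

section \<open>Copies of left vertices\<close>

text \<open>Weak compositions: parts may be 0.\<close>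

definition compositions :: "nat \<Rightarrow> nat \<Rightarrow> (nat \<Rightarrow> nat) set" where
  "compositions k n = {y. (\<forall>t\<ge>k. y t = 0) \<and> sum y {..<k} = n}"

text \<open>The coefficient of z^n in the \<open>k\<close>-th power of the generating series of
  \<open>w\<close>.\<close>

definition weight_sum :: "(nat \<Rightarrow> 'c::comm_semiring_1) \<Rightarrow> nat \<Rightarrow> nat \<Rightarrow> 'c" where
  "weight_sum w k n = (\<Sum>y\<in>compositions k n. \<Prod>t<k. w (y t))"

lemma finite_compositions [simp]: "finite (compositions k n)"
proof (rule finite_subset[OF _ finite_bounded_supported[of "{..<k}" n]])
  show "compositions k n \<subseteq> {b. (\<forall>r. r \<notin> {..<k} \<longrightarrow> b r = 0) \<and> (\<forall>r\<in>{..<k}. b r \<le> n)}"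
    by (auto simp: compositions_def intro: member_le_sum)
qed simp

lemma weight_sum_0 [simp]: "weight_sum w 0 n = of_bool (n = 0)"
proof -
  have "compositions 0 n = (if n = 0 then {\<lambda>_. 0} else {})"
    by (auto simp: compositions_def)
  then show ?thesis by (simp add: weight_sum_def)
qed

text \<open>The Cauchy product, obtained by splitting off the last part \<open>y k\<close>.\<close>

lemma weight_sum_Suc: "weight_sum w (Suc k) n = (\<Sum>j\<le>n. w j * weight_sum w k (n - j))"
proof -
  have "(\<Sum>j\<le>n. w j * weight_sum w k (n - j)) =
      (\<Sum>j\<le>n. \<Sum>y\<in>compositions k (n - j). w j * (\<Prod>t<k. w (y t)))"
    by (simp add: weight_sum_def sum_distrib_left)
  also have "\<dots> = (\<Sum>(j, y)\<in>Sigma {..n} (\<lambda>j. compositions k (n - j)). w j * (\<Prod>t<k. w (y t)))"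
    by (subst sum.Sigma) auto
  also have "\<dots> = (\<Sum>y\<in>compositions (Suc k) n. \<Prod>t<Suc k. w (y t))"
  proof (rule sum.reindex_bij_witness[of _ "\<lambda>y. (y k, y(k := 0))" "\<lambda>(j, y). y(k := j)"])
    fix p assume p: "p \<in> Sigma {..n} (\<lambda>j. compositions k (n - j))"
    obtain j y where pe: "p = (j, y)" by (cases p)
    have y: "j \<le> n" "\<forall>t\<ge>k. y t = 0" "sum y {..<k} = n - j" using p by (auto simp: pe compositions_def)
    show "(\<lambda>y. (y k, y(k := 0))) ((\<lambda>(j, y). y(k := j)) p) = p"
      using y by (auto simp: pe fun_eq_iff)
    have "sum (y(k := j)) {..<k} = sum y {..<k}" by (intro sum.cong) auto
    then show "(\<lambda>(j, y). y(k := j)) p \<in> compositions (Suc k) n"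
      using y by (auto simp: pe compositions_def)
    have "(\<Prod>t<k. w ((y(k := j)) t)) = (\<Prod>t<k. w (y t))" by (intro prod.cong) auto
    then show "(\<Prod>t<Suc k. w ((case p of (j, y) \<Rightarrow> y(k := j)) t)) =
        (case p of (j, y) \<Rightarrow> w j * (\<Prod>t<k. w (y t)))"
      by (simp add: pe mult.commute)
  next
    fix y assume y: "y \<in> compositions (Suc k) n"
    have "sum (y(k := 0)) {..<k} = sum y {..<k}" by (intro sum.cong) auto
    then show "(y k, y(k := 0)) \<in> Sigma {..n} (\<lambda>j. compositions k (n - j))"
      using y by (auto simp: compositions_def)
  qed auto
  finally show ?thesis by (simp add: weight_sum_def)
qed

text \<open>Substitution of qz for z in the generating series.\<close>

lemma weight_sum_hom:
  "weight_sum (\<lambda>n. q ^ n * of_nat (w n)) k n = q ^ n * of_nat (weight_sum w k n)"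
proof -
  have "(\<Prod>t<k. q ^ y t * of_nat (w (y t))) = q ^ n * of_nat (\<Prod>t<k. w (y t))"
    if "y \<in> compositions k n" for y
    using that by (simp add: prod.distrib power_sum[symmetric] compositions_def)
  then show ?thesis by (simp add: weight_sum_def sum_distrib_left)
qed

section \<open>Blowing up left vertices\<close>

definition copy_edges :: "('a \<times> 'b) set \<Rightarrow> (('a \<times> nat) \<times> 'b) set" where
  "copy_edges E = {((i, t), r) |i t r. (i, r) \<in> E}"

text \<open>In \<open>copy_edges\<close> each left vertex has infinitely many copies; this vertex
  set selects the first \<open>k i\<close> of them.\<close>

definition copies :: "'a set \<Rightarrow> ('a \<Rightarrow> nat) \<Rightarrow> ('a \<times> nat) set" where
  "copies L k = Sigma L (\<lambda>i. {..<k i})"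

definition block_sum :: "('a \<Rightarrow> nat) \<Rightarrow> ('a \<times> nat \<Rightarrow> nat) \<Rightarrow> 'a \<Rightarrow> nat" where
  "block_sum k x i = (\<Sum>t<k i. x (i, t))"

lemma finite_copies [simp]: "finite L \<Longrightarrow> finite (copies L k)"
  by (auto simp: copies_def)

lemma sum_copies: "finite L \<Longrightarrow> sum x (copies L k) = sum (block_sum k x) L"
  by (simp add: copies_def block_sum_def sum.Sigma)

lemma nb_copy_edges_converse: "nb ((copy_edges E)\<inverse>) R J = nb (E\<inverse>) R (fst ` J)"
  by (force simp: nb_def copy_edges_def)

text \<open>Copies of a vertex share their neighbours, so among the sets of copies over a given set
  of left vertices the full blocks give the strongest inequality.\<close>

lemma draconians_copies_iff:
  assumes fin: "finite L" "finite R" and z: "\<And>q. q \<notin> copies L k \<Longrightarrow> x q = 0"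
  shows "x \<in> draconians ((copy_edges E)\<inverse>) R (copies L k) \<longleftrightarrow> block_sum k x \<in> draconians (E\<inverse>) R L"
proof
  assume x: "x \<in> draconians ((copy_edges E)\<inverse>) R (copies L k)"
  show "block_sum k x \<in> draconians (E\<inverse>) R L"
  proof (rule draconiansI)
    fix i assume "i \<notin> L"
    then have "x (i, t) = 0" for t by (intro z) (simp add: copies_def)
    then show "block_sum k x i = 0" by (simp add: block_sum_def)
  next
    fix J assume J: "J \<subseteq> L"
    have "sum (block_sum k x) J = sum x (copies J k)"
      using J fin finite_subset by (intro sum_copies[symmetric]) blast
    also have "\<dots> \<le> card (nb ((copy_edges E)\<inverse>) R (copies J k))"
      using J by (intro draconiansD(2)[OF x]) (auto simp: copies_def)
    also have "\<dots> \<le> card (nb (E\<inverse>) R J)"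
      unfolding nb_copy_edges_converse using fin
      by (intro card_mono nb_mono) (auto simp: copies_def)
    finally show "sum (block_sum k x) J \<le> card (nb (E\<inverse>) R J)" .
  qed
next
  assume a: "block_sum k x \<in> draconians (E\<inverse>) R L"
  show "x \<in> draconians ((copy_edges E)\<inverse>) R (copies L k)"
  proof (rule draconiansI)
    fix J assume J: "J \<subseteq> copies L k"
    let ?J = "fst ` J"
    have sub: "?J \<subseteq> L" using J by (auto simp: copies_def)
    then have fJ: "finite ?J" using fin finite_subset by blast
    have "sum x J \<le> sum x (copies ?J k)"
      using J fJ by (intro sum_mono2) (force simp: copies_def)+
    also have "\<dots> = sum (block_sum k x) ?J" by (rule sum_copies[OF fJ])
    also have "\<dots> \<le> card (nb (E\<inverse>) R ?J)" by (rule draconiansD(2)[OF a sub])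
    finally show "sum x J \<le> card (nb ((copy_edges E)\<inverse>) R J)"
      by (simp add: nb_copy_edges_converse)
  qed (use z in auto)
qed

text \<open>The terms are sorted by their block sums \<open>a\<close>. The fibre over
  \<open>a\<close> is the product over \<open>i\<close> of the compositions of \<open>a i\<close>
  into \<open>k i\<close> parts, so its sum factorises.\<close>

theorem sum_draconians_copies:
  fixes w :: "nat \<Rightarrow> 'c::comm_semiring_1"
  assumes fin: "finite L" "finite R"
  shows "(\<Sum>x\<in>draconians ((copy_edges E)\<inverse>) R (copies L k). \<Prod>q\<in>copies L k. w (x q)) =
    (\<Sum>a\<in>draconians (E\<inverse>) R L. \<Prod>i\<in>L. weight_sum w (k i) (a i))"
proof -
  let ?D = "draconians ((copy_edges E)\<inverse>) R (copies L k)"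
  let ?X = "\<lambda>a. {x \<in> ?D. block_sum k x = a}"
  let ?C = "\<lambda>a. PiE L (\<lambda>i. compositions (k i) (a i))"
  have fibre: "(\<Sum>x\<in>?X a. \<Prod>q\<in>copies L k. w (x q)) = (\<Prod>i\<in>L. weight_sum w (k i) (a i))"
    if a: "a \<in> draconians (E\<inverse>) R L" for a
  proof -
    have "(\<Prod>i\<in>L. weight_sum w (k i) (a i)) = (\<Sum>g\<in>?C a. \<Prod>i\<in>L. \<Prod>t<k i. w (g i t))"
      unfolding weight_sum_def using fin by (intro prod_sum_PiE) auto
    also have "\<dots> = (\<Sum>x\<in>?X a. \<Prod>q\<in>copies L k. w (x q))"
    proof (rule sum.reindex_bij_witness[of _ "\<lambda>x. restrict (\<lambda>i t. x (i, t)) L"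
            "\<lambda>g (i, t). if i \<in> L then g i t else 0"])
      fix g assume g: "g \<in> ?C a"
      let ?x = "\<lambda>(i, t). if i \<in> L then g i t else 0"
      have g0: "g i t = 0" if "i \<in> L" "t \<ge> k i" for i t
        using g that by (auto simp: PiE_def Pi_def compositions_def)
      have gs: "sum (g i) {..<k i} = a i" if "i \<in> L" for i
        using g that by (auto simp: PiE_def Pi_def compositions_def)
      show "restrict (\<lambda>i t. ?x (i, t)) L = g"
        using g by (auto simp: fun_eq_iff PiE_def extensional_def)
      have "block_sum k ?x i = a i" for i
        using gs[of i] draconiansD(1)[OF a, of i] by (cases "i \<in> L") (auto simp: block_sum_def)
      then have bs: "block_sum k ?x = a" by auto
      have "?x q = 0" if "q \<notin> copies L k" for q
        using that g0 by (cases q) (auto simp: copies_def)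
      then have "?x \<in> ?D" using draconians_copies_iff[OF fin, of k ?x E] bs a by simp
      then show "?x \<in> ?X a" using bs by simp
      have "(\<Prod>q\<in>copies L k. w (?x q)) = (\<Prod>i\<in>L. \<Prod>t<k i. w (?x (i, t)))"
        unfolding copies_def using fin by (subst prod.Sigma) (auto simp: case_prod_beta cong: if_cong)
      also have "\<dots> = (\<Prod>i\<in>L. \<Prod>t<k i. w (g i t))" by (intro prod.cong) auto
      finally show "(\<Prod>q\<in>copies L k. w (?x q)) = (\<Prod>i\<in>L. \<Prod>t<k i. w (g i t))" .
    next
      fix x assume x: "x \<in> ?X a"
      then have z: "x (i, t) = 0" if "\<not> (i \<in> L \<and> t < k i)" for i t
        using that by (auto simp: copies_def dest: draconiansD(1))
      show "restrict (\<lambda>i t. x (i, t)) L \<in> ?C a"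
        using x z by (auto simp: compositions_def block_sum_def)
      show "(\<lambda>(i, t). if i \<in> L then restrict (\<lambda>i t. x (i, t)) L i t else 0) = x"
        using z by (auto simp: fun_eq_iff)
    qed
    finally show ?thesis by simp
  qed
  have "block_sum k ` ?D \<subseteq> draconians (E\<inverse>) R L"
    using draconians_copies_iff[OF fin, of k _ E] by (auto dest: draconiansD(1))
  then have "(\<Sum>x\<in>?D. \<Prod>q\<in>copies L k. w (x q)) =
      (\<Sum>a\<in>draconians (E\<inverse>) R L. \<Sum>x\<in>?X a. \<Prod>q\<in>copies L k. w (x q))"
    using fin by (intro sum.group[symmetric]) auto
  also have "\<dots> = (\<Sum>a\<in>draconians (E\<inverse>) R L. \<Prod>i\<in>L. weight_sum w (k i) (a i))"
    using fibre by (intro sum.cong) auto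
  finally show ?thesis .
qed

section \<open>Signed counts of compositions into positive parts\<close>

lemma weight_sum_of_bool_eq_0:
  assumes "n < k"
  shows "weight_sum (\<lambda>j. of_bool (0 < j) :: int) k n = 0"
proof -
  have "\<exists>t<k. y t = 0" if "y \<in> compositions k n" for y
  proof (rule ccontr)
    assume "\<not> (\<exists>t<k. y t = 0)"
    then have "(\<Sum>t<k. 1) \<le> sum y {..<k}" by (intro sum_mono) (auto simp: Suc_le_eq)
    then show False using that assms by (auto simp: compositions_def)
  qed
  then have "(\<Prod>t<k. of_bool (0 < y t) :: int) = 0" if "y \<in> compositions k n" for y
    using \<open>\<And>y. y \<in> compositions k n \<Longrightarrow> \<exists>t<k. y t = 0\<close>[OF that] by (intro prod_zero) auto
  then show ?thesis unfolding weight_sum_def by (intro sum.neutral ballI)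
qed

text \<open>The generating series is 1/(1 + 2z/(1-z)) = (1-z)/(1+z). The bound \<open>N\<close> may
  exceed \<open>n\<close>, because there is no composition of \<open>n\<close> into more than
  \<open>n\<close> positive parts; this freedom is used in the induction.\<close>

lemma sum_alternating_weight_sum:
  assumes "n \<le> N"
  shows "(\<Sum>k\<le>N. (-2) ^ k * weight_sum (\<lambda>j. of_bool (0 < j) :: int) k n) =
    (if n = 0 then 1 else 2 * (-1) ^ n)"
  using assms
proof (induction n arbitrary: N rule: less_induct)
  case (less n)
  let ?W = "weight_sum (\<lambda>j. of_bool (0 < j) :: int)"
  show ?case
  proof (cases n)
    case 0
    have "(\<Sum>k\<le>N. (-2) ^ k * ?W k 0) = (\<Sum>k\<in>{0}. (-2) ^ k * ?W k 0)"
      by (intro sum.mono_neutral_right) (auto intro: weight_sum_of_bool_eq_0)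
    then show ?thesis using 0 by simp
  next
    case (Suc m)
    then obtain M where N: "N = Suc M" and M: "m \<le> M" using less.prems by (cases N) auto
    \<comment> \<open>A positive last part is split off, leaving any remainder from 0 to
      \<open>n - 1\<close>.\<close>
    have W: "?W (Suc k) n = (\<Sum>j\<le>m. ?W k j)" for k
    proof -
      have "?W (Suc k) n = (\<Sum>j\<le>n. of_bool (0 < j) * ?W k (n - j))" by (rule weight_sum_Suc)
      also have "\<dots> = (\<Sum>j\<le>m. ?W k (n - Suc j))"
        unfolding Suc sum.atMost_Suc_shift by simp
      also have "\<dots> = (\<Sum>j\<le>m. ?W k j)"
        by (rule sum.reindex_bij_witness[of _ "\<lambda>j. m - j" "\<lambda>j. m - j"]) (auto simp: Suc)
      finally show ?thesis .
    qed
    have alt: "(\<Sum>j\<le>m. if j = 0 then 1 else 2 * (-1) ^ j :: int) = (-1) ^ m" for m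
      by (induction m) auto
    have "(\<Sum>k\<le>N. (-2) ^ k * ?W k n) = (\<Sum>k\<le>M. (-2) ^ Suc k * ?W (Suc k) n)"
      unfolding N sum.atMost_Suc_shift by (simp add: Suc del: power_Suc)
    also have "\<dots> = (\<Sum>k\<le>M. \<Sum>j\<le>m. -2 * ((-2) ^ k * ?W k j))"
      by (simp add: W sum_distrib_left mult.assoc)
    also have "\<dots> = (\<Sum>j\<le>m. \<Sum>k\<le>M. -2 * ((-2) ^ k * ?W k j))"
      by (rule sum.swap)
    also have "\<dots> = (\<Sum>j\<le>m. -2 * (if j = 0 then 1 else 2 * (-1) ^ j))"
    proof (intro sum.cong refl)
      fix j assume "j \<in> {..m}"
      then show "(\<Sum>k\<le>M. -2 * ((-2) ^ k * ?W k j)) = -2 * (if j = 0 then 1 else 2 * (-1) ^ j)"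
        using less.IH[of j M] M Suc by (simp only: sum_distrib_left[symmetric]) simp
    qed
    also have "\<dots> = -2 * (\<Sum>j\<le>m. if j = 0 then 1 else 2 * (-1) ^ j :: int)"
      by (rule sum_distrib_left[symmetric])
    also have "\<dots> = 2 * (-1) ^ n" unfolding alt by (simp add: Suc)
    finally show ?thesis using Suc by simp
  qed
qed

section \<open>Strict draconian sequences\<close>

text \<open>Expansion of the product over \<open>x\<close> in \<open>R\<close> of -2 + [x not in T],
  whose factors are -2 on \<open>T\<close> and -1 elsewhere. It rewrites \<open>2 ^ card T\<close>
  as a signed sum over the supersets of \<open>T\<close>.\<close>

lemma sum_Pow_supersets:
  assumes "finite R" "T \<subseteq> R"
  shows "(\<Sum>S\<in>Pow R. (-2) ^ card S * of_bool (T \<subseteq> S) :: int) = (-1) ^ card R * 2 ^ card T"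
proof -
  have "(\<Sum>S\<in>Pow R. (-2) ^ card S * of_bool (T \<subseteq> S) :: int) =
      (\<Sum>S\<in>Pow R. (\<Prod>x\<in>S. -2) * (\<Prod>x\<in>R - S. of_bool (x \<notin> T)))"
  proof (intro sum.cong refl)
    fix S assume "S \<in> Pow R"
    have "(\<Prod>x\<in>R - S. of_bool (x \<notin> T)) = (of_bool (T \<subseteq> S) :: int)"
    proof (cases "T \<subseteq> S")
      case True
      then show ?thesis by (auto intro!: prod.neutral)
    next
      case False
      then have "\<exists>x\<in>R - S. of_bool (x \<notin> T) = (0 :: int)" using assms(2) by auto
      then have "(\<Prod>x\<in>R - S. of_bool (x \<notin> T)) = (0 :: int)"
        using assms(1) by (intro prod_zero) auto
      then show ?thesis using False by simp
    qed
    then show "(-2) ^ card S * of_bool (T \<subseteq> S) =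
        (\<Prod>x\<in>S. -2) * (\<Prod>x\<in>R - S. of_bool (x \<notin> T) :: int)"
      by simp
  qed
  also have "\<dots> = (\<Prod>x\<in>R. -2 + of_bool (x \<notin> T))"
    by (rule prod_add[OF assms(1), symmetric])
  also have "\<dots> = (\<Prod>x\<in>R. -1 * (if x \<in> T then 2 else 1))"
    by (intro prod.cong) auto
  also have "\<dots> = (-1) ^ card R * (\<Prod>x\<in>R. if x \<in> T then 2 else 1)"
    unfolding prod.distrib by simp
  also have "(\<Prod>x\<in>R. if x \<in> T then 2 else 1 :: int) = (\<Prod>x\<in>T. 2)"
    using assms by (intro prod.mono_neutral_cong_right) auto
  finally show ?thesis by simp
qed

text \<open>A function supported in \<open>S\<close> is tested on the part of a set inside
  \<open>S\<close>. On a nonempty set disjoint from \<open>S\<close> the sum is 0, and the strict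
  inequality follows from \<open>cov\<close>.\<close>

lemma strict_draconians_restrict:
  assumes fin: "finite L" "finite R" and S: "S \<subseteq> R" and cov: "\<And>r. r \<in> R \<Longrightarrow> nb E L {r} \<noteq> {}"
  shows "{b \<in> strict_draconians E L R. {r \<in> R. 0 < b r} \<subseteq> S} = strict_draconians E L S"
proof (intro equalityI subsetI)
  fix b assume "b \<in> {b \<in> strict_draconians E L R. {r \<in> R. 0 < b r} \<subseteq> S}"
  then have b: "b \<in> strict_draconians E L R" and supp: "{r \<in> R. 0 < b r} \<subseteq> S" by auto
  show "b \<in> strict_draconians E L S"
  proof (rule strict_draconiansI)
    fix r assume "r \<notin> S"
    then show "b r = 0" using supp strict_draconiansD(1)[OF b, of r] by (cases "r \<in> R") auto
  next
    fix T assume "T \<subseteq> S" "T \<noteq> {}"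
    then show "sum b T < card (nb E L T)" using S by (intro strict_draconiansD(2)[OF b]) auto
  qed
next
  fix b assume b: "b \<in> strict_draconians E L S"
  have "b \<in> strict_draconians E L R"
  proof (rule strict_draconiansI)
    fix r assume "r \<notin> R"
    then show "b r = 0" using S by (intro strict_draconiansD(1)[OF b]) auto
  next
    fix T assume T: "T \<subseteq> R" "T \<noteq> {}"
    then have fT: "finite T" using fin finite_subset by blast
    have sT: "sum b T = sum b (T \<inter> S)"
      using fT strict_draconiansD(1)[OF b] by (intro sum_restrict_support) auto
    show "sum b T < card (nb E L T)"
    proof (cases "T \<inter> S = {}")
      case True
      obtain r where "r \<in> T" using T by blast
      then have "nb E L {r} \<subseteq> nb E L T" "nb E L {r} \<noteq> {}" using cov T by (auto intro!: nb_mono)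
      then have "nb E L T \<noteq> {}" by blast
      moreover have "sum b T = 0" using sT unfolding True by simp
      ultimately show ?thesis using fin by (simp add: card_gt_0_iff)
    next
      case False
      then have "sum b (T \<inter> S) < card (nb E L (T \<inter> S))" by (intro strict_draconiansD(2)[OF b]) auto
      also have "\<dots> \<le> card (nb E L T)" using fin by (intro card_mono nb_mono) auto
      finally show ?thesis using sT by simp
    qed
  qed
  moreover have "{r \<in> R. 0 < b r} \<subseteq> S"
    using strict_draconiansD(1)[OF b] by (metis (mono_tags, lifting) less_numeral_extra(3) mem_Collect_eq subsetI)
  ultimately show "b \<in> {b \<in> strict_draconians E L R. {r \<in> R. 0 < b r} \<subseteq> S}" by simp
qed

lemma draconians_mono:
  assumes "finite L" "L' \<subseteq> L"
  shows "draconians E L' R \<subseteq> draconians E L R"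
proof
  fix b assume b: "b \<in> draconians E L' R"
  show "b \<in> draconians E L R"
  proof (rule draconiansI)
    fix S assume "S \<subseteq> R"
    then have "sum b S \<le> card (nb E L' S)" by (rule draconiansD(2)[OF b])
    also have "\<dots> \<le> card (nb E L S)" using assms by (intro card_mono) (auto simp: nb_def)
    finally show "sum b S \<le> card (nb E L S)" .
  qed (rule draconiansD(1)[OF b])
qed

text \<open>The indicator function of \<open>copies L p\<close> has block sums \<open>p\<close>, so
  Hall's condition for the copies is the draconian condition for \<open>p\<close>, and equality of
  sizes is tightness.\<close>

lemma matchable_copies_iff:
  assumes fin: "finite L" "finite S" and z: "\<And>i. i \<notin> L \<Longrightarrow> p i = 0"
  shows "matchable (copy_edges E) (copies L p) S \<longleftrightarrow> p \<in> draconians (E\<inverse>) S L \<and> sum p L = card S"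
proof -
  let ?e = "\<lambda>q. of_bool (q \<in> copies L p) :: nat"
  have bs: "block_sum p ?e = p"
  proof
    fix i
    show "block_sum p ?e i = p i"
      using z[of i] by (cases "i \<in> L") (auto simp: block_sum_def copies_def)
  qed
  have "card (copies L p) = sum p L"
    using fin by (simp add: copies_def card_SigmaI)
  moreover have "matchable (copy_edges E) (copies L p) S \<longleftrightarrow> matchable ((copy_edges E)\<inverse>) S (copies L p)"
    using fin by (intro matchable_converse[symmetric]) auto
  moreover have "?e \<in> draconians ((copy_edges E)\<inverse>) S (copies L p) \<longleftrightarrow> p \<in> draconians (E\<inverse>) S L"
    using draconians_copies_iff[OF fin, of p ?e E] bs by simp
  ultimately show ?thesis
    using matchable_iff_draconian[of "(copy_edges E)\<inverse>" S "copies L p"] by auto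
qed

text \<open>The sets matched with the copies are counted by positive draconian sequences on the
  copies, which are then collected by block sums.\<close>

lemma sum_matchable_copies:
  assumes fin: "finite L" "finite R"
  shows "(\<Sum>S\<in>Pow R. of_bool (matchable (copy_edges E) (copies L p) S) :: int) =
    (\<Sum>a\<in>draconians (E\<inverse>) R L. \<Prod>i\<in>L. weight_sum (\<lambda>j. of_bool (0 < j)) (p i) (a i))"
proof -
  let ?D = "draconians ((copy_edges E)\<inverse>) R (copies L p)"
  have "(\<Sum>S\<in>Pow R. of_bool (matchable (copy_edges E) (copies L p) S) :: int) =
      int (\<Sum>S\<in>Pow R. of_bool (matchable (copy_edges E) (copies L p) S))"
    by (simp only: of_nat_sum of_nat_of_bool)
  also have "\<dots> = int (card (positives ((copy_edges E)\<inverse>) R (copies L p)))"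
    using fin by (subst card_positives(2)) auto
  also have "\<dots> = (\<Sum>x\<in>?D. of_bool (\<forall>q\<in>copies L p. 0 < x q))"
    unfolding positives_def using fin by (simp add: Int_def)
  also have "\<dots> = (\<Sum>x\<in>?D. \<Prod>q\<in>copies L p. of_bool (0 < x q))"
  proof (intro sum.cong refl)
    fix x :: "'a \<times> nat \<Rightarrow> nat"
    show "of_bool (\<forall>q\<in>copies L p. 0 < x q) = (\<Prod>q\<in>copies L p. of_bool (0 < x q) :: int)"
    proof (cases "\<forall>q\<in>copies L p. 0 < x q")
      case False
      then have "(\<Prod>q\<in>copies L p. of_bool (0 < x q) :: int) = 0"
        using fin by (intro prod_zero) auto
      then show ?thesis using False by simp
    qed simp
  qed
  also have "\<dots> = (\<Sum>a\<in>draconians (E\<inverse>) R L. \<Prod>i\<in>L. weight_sum (\<lambda>j. of_bool (0 < j)) (p i) (a i))"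
    by (rule sum_draconians_copies[OF fin])
  finally show ?thesis .
qed

text \<open>Only those \<open>p\<close> with \<open>p i \<le> a i\<close> for all \<open>i\<close>
  contribute, and every such \<open>p\<close> is draconian because \<open>a\<close> is. The sum
  therefore runs over a box and factorises over the vertices.\<close>

lemma sum_draconians_alternating:
  fixes a :: "'a \<Rightarrow> nat"
  assumes fin: "finite L" "finite R" and a: "a \<in> draconians (E\<inverse>) R L"
  shows "(\<Sum>p\<in>draconians (E\<inverse>) R L. (-2) ^ sum p L *
      (\<Prod>i\<in>L. weight_sum (\<lambda>j. of_bool (0 < j) :: int) (p i) (a i))) =
    (-1) ^ sum a L * 2 ^ card {i \<in> L. 0 < a i}"
proof -
  let ?W = "weight_sum (\<lambda>j. of_bool (0 < j) :: int)"
  let ?g = "\<lambda>p. (-2) ^ sum p L * (\<Prod>i\<in>L. ?W (p i) (a i))"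
  let ?B = "{p. (\<forall>i. i \<notin> L \<longrightarrow> p i = 0) \<and> (\<forall>i\<in>L. p i \<le> a i)}"
  have "sum ?g (draconians (E\<inverse>) R L) = sum ?g ?B"
  proof (rule sum.mono_neutral_right)
    show "?B \<subseteq> draconians (E\<inverse>) R L"
    proof
      fix p assume p: "p \<in> ?B"
      show "p \<in> draconians (E\<inverse>) R L"
      proof (rule draconiansI)
        fix J assume J: "J \<subseteq> L"
        have "sum p J \<le> sum a J" using p J by (intro sum_mono) auto
        also have "\<dots> \<le> card (nb (E\<inverse>) R J)" by (rule draconiansD(2)[OF a J])
        finally show "sum p J \<le> card (nb (E\<inverse>) R J)" .
      qed (use p in auto)
    qed
    show "\<forall>p\<in>draconians (E\<inverse>) R L - ?B. ?g p = 0"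
    proof
      fix p assume p: "p \<in> draconians (E\<inverse>) R L - ?B"
      then obtain i where "i \<in> L" "a i < p i" by (auto simp: not_le dest: draconiansD(1))
      then have "\<exists>i\<in>L. ?W (p i) (a i) = 0" using weight_sum_of_bool_eq_0 by blast
      then have "(\<Prod>i\<in>L. ?W (p i) (a i)) = 0" using fin by (intro prod_zero) auto
      then show "?g p = 0" by simp
    qed
  qed (use fin in simp)
  also have "\<dots> = (\<Sum>p\<in>?B. \<Prod>i\<in>L. (-2) ^ p i * ?W (p i) (a i))"
    by (simp add: prod.distrib power_sum)
  also have "\<dots> = (\<Sum>p\<in>PiE L (\<lambda>i. {..a i}). \<Prod>i\<in>L. (-2) ^ p i * ?W (p i) (a i))"
  proof (rule sum.reindex_bij_witness[of _ "\<lambda>p i. if i \<in> L then p i else 0" "\<lambda>p. restrict p L"])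
    fix p assume "p \<in> ?B"
    show "(\<Prod>i\<in>L. (-2) ^ restrict p L i * ?W (restrict p L i) (a i)) =
        (\<Prod>i\<in>L. (-2) ^ p i * ?W (p i) (a i))"
      by (intro prod.cong) auto
  qed (auto simp: fun_eq_iff PiE_def extensional_def)
  also have "\<dots> = (\<Prod>i\<in>L. \<Sum>k\<le>a i. (-2) ^ k * ?W k (a i))"
    using fin by (intro prod_sum_PiE[symmetric]) auto
  also have "\<dots> = (\<Prod>i\<in>L. (-1) ^ a i * (if 0 < a i then 2 else 1))"
    by (intro prod.cong refl) (subst sum_alternating_weight_sum, auto)
  also have "\<dots> = (-1) ^ sum a L * (\<Prod>i\<in>L. if 0 < a i then 2 else 1)"
    by (simp add: prod.distrib power_sum)
  also have "(\<Prod>i\<in>L. if 0 < a i then 2 else 1 :: int) = (\<Prod>i\<in>{i \<in> L. 0 < a i}. 2)"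
    using fin by (intro prod.mono_neutral_cong_right) auto
  finally show ?thesis by simp
qed

text \<open>Each power of 2 is expanded over the supersets \<open>S\<close> of the support, giving
  signed counts of \<open>strict_draconians E L S\<close>. Duality turns these into pairs of a
  draconian \<open>p\<close> and a set \<open>S\<close> matched to its copies; the sum over
  \<open>S\<close> introduces \<open>a\<close>, and the sum over \<open>p\<close> then
  collapses.\<close>

theorem sum_two_power_strict_draconians:
  fixes E :: "('a \<times> 'b) set"
  assumes fin: "finite L" "finite R" and cov: "\<And>r. r \<in> R \<Longrightarrow> nb E L {r} \<noteq> {}"
  shows "(\<Sum>b\<in>strict_draconians E L R. 2 ^ card {r \<in> R. 0 < b r} :: int) =
    (\<Sum>a\<in>draconians (E\<inverse>) R L. (-1) ^ (card R + sum a L) * 2 ^ card {i \<in> L. 0 < a i})"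
proof -
  let ?V = "strict_draconians E L R" and ?D = "draconians (E\<inverse>) R L"
  let ?m = "\<lambda>p S. of_bool (matchable (copy_edges E) (copies L p) S) :: int"
  let ?W = "\<lambda>p a. \<Prod>i\<in>L. weight_sum (\<lambda>j. of_bool (0 < j) :: int) (p i) (a i)"
  have finV: "finite ?V" by (rule finite_subset[OF strict_draconians_subset]) (simp add: fin)
  \<comment> \<open>The range \<open>?D\<close> does not depend on \<open>S\<close>, so the two
    summations can be exchanged.\<close>
  have tight: "int (card (strict_draconians E L S)) = (\<Sum>p\<in>?D. ?m p S)" if S: "S \<subseteq> R" for S
  proof -
    have fS: "finite S" using S fin finite_subset by blast
    have "card (strict_draconians E L S) = card {p \<in> draconians (E\<inverse>) S L. sum p L = card S}"
      using card_tight_draconians[OF fS fin(1), of "E\<inverse>"] by simp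
    also have "{p \<in> draconians (E\<inverse>) S L. sum p L = card S} =
        {p \<in> ?D. matchable (copy_edges E) (copies L p) S}"
    proof -
      have "matchable (copy_edges E) (copies L p) S \<longleftrightarrow>
          p \<in> draconians (E\<inverse>) S L \<and> sum p L = card S" if "p \<in> ?D" for p
        by (rule matchable_copies_iff[OF fin(1) fS]) (rule draconiansD(1)[OF that])
      then show ?thesis using draconians_mono[OF fin(2) S, of "E\<inverse>" L] by blast
    qed
    finally show ?thesis using fin by (simp add: Int_def)
  qed
  have "(\<Sum>b\<in>?V. 2 ^ card {r \<in> R. 0 < b r} :: int) =
      (\<Sum>b\<in>?V. \<Sum>S\<in>Pow R. (-1) ^ card R * ((-2) ^ card S * of_bool ({r \<in> R. 0 < b r} \<subseteq> S)))"
  proof (intro sum.cong refl)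
    fix b :: "'b \<Rightarrow> nat"
    have "{r \<in> R. 0 < b r} \<subseteq> R" by auto
    note sup = sum_Pow_supersets[OF fin(2) this]
    show "2 ^ card {r \<in> R. 0 < b r} =
        (\<Sum>S\<in>Pow R. (-1) ^ card R * ((-2) ^ card S * of_bool ({r \<in> R. 0 < b r} \<subseteq> S)) :: int)"
      unfolding sum_distrib_left[symmetric] sup by simp
  qed
  also have "\<dots> = (\<Sum>S\<in>Pow R. \<Sum>b\<in>?V. (-1) ^ card R * ((-2) ^ card S * of_bool ({r \<in> R. 0 < b r} \<subseteq> S)))"
    by (rule sum.swap)
  also have "\<dots> = (\<Sum>S\<in>Pow R. (-1) ^ card R * ((-2) ^ card S * int (card (strict_draconians E L S))))"
  proof (intro sum.cong refl)
    fix S assume S: "S \<in> Pow R"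
    have "strict_draconians E L S = {b \<in> ?V. {r \<in> R. 0 < b r} \<subseteq> S}"
      using strict_draconians_restrict[OF fin, of S E] S cov by auto
    then have "int (card (strict_draconians E L S)) = (\<Sum>b\<in>?V. of_bool ({r \<in> R. 0 < b r} \<subseteq> S))"
      using finV by (simp add: Int_def)
    then show "(\<Sum>b\<in>?V. (-1) ^ card R * ((-2) ^ card S * of_bool ({r \<in> R. 0 < b r} \<subseteq> S))) =
        (-1) ^ card R * ((-2) ^ card S * int (card (strict_draconians E L S)))"
      by (simp only: sum_distrib_left)
  qed
  also have "\<dots> = (\<Sum>S\<in>Pow R. \<Sum>p\<in>?D. (-1) ^ card R * ((-2) ^ sum p L * ?m p S))"
  proof (intro sum.cong refl)
    fix S assume S: "S \<in> Pow R"
    then have fS: "finite S" using fin finite_subset by blast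
    \<comment> \<open>A matched pair has \<open>card S = sum p L\<close>, which frees the weight
      from \<open>S\<close>.\<close>
    have eq: "(-2) ^ card S * ?m p S = (-2) ^ sum p L * ?m p S" if "p \<in> ?D" for p
      using matchable_copies_iff[OF fin(1) fS, of p E] draconiansD(1)[OF that] by auto
    have SR: "S \<subseteq> R" using S by simp
    have "(-2) ^ card S * int (card (strict_draconians E L S)) = (\<Sum>p\<in>?D. (-2) ^ card S * ?m p S)"
      by (simp only: tight[OF SR] sum_distrib_left)
    also have "\<dots> = (\<Sum>p\<in>?D. (-2) ^ sum p L * ?m p S)" by (intro sum.cong refl eq)
    finally show "(-1) ^ card R * ((-2) ^ card S * int (card (strict_draconians E L S))) =
        (\<Sum>p\<in>?D. (-1) ^ card R * ((-2) ^ sum p L * ?m p S))"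
      by (simp only: sum_distrib_left)
  qed
  also have "\<dots> = (\<Sum>p\<in>?D. \<Sum>S\<in>Pow R. (-1) ^ card R * ((-2) ^ sum p L * ?m p S))"
    by (rule sum.swap)
  also have "\<dots> = (\<Sum>p\<in>?D. \<Sum>a\<in>?D. (-1) ^ card R * ((-2) ^ sum p L * ?W p a))"
    unfolding sum_distrib_left[symmetric] sum_matchable_copies[OF fin] ..
  also have "\<dots> = (\<Sum>a\<in>?D. \<Sum>p\<in>?D. (-1) ^ card R * ((-2) ^ sum p L * ?W p a))"
    by (rule sum.swap)
  also have "\<dots> = (\<Sum>a\<in>?D. (-1) ^ (card R + sum a L) * 2 ^ card {i \<in> L. 0 < a i})"
  proof (intro sum.cong refl)
    fix a assume "a \<in> ?D"
    note alt = sum_draconians_alternating[OF fin this]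
    show "(\<Sum>p\<in>?D. (-1) ^ card R * ((-2) ^ sum p L * ?W p a)) =
        (-1) ^ (card R + sum a L) * 2 ^ card {i \<in> L. 0 < a i}"
      unfolding sum_distrib_left[symmetric] alt by (simp add: power_add mult.assoc)
  qed
  finally show ?thesis .
qed

section \<open>The polytope\<close>

text \<open>The number of neighbours of \<open>S\<close> in the graph with \<open>k j\<close> copies
  of the left vertex \<open>j\<close>.\<close>

definition cover_weight :: "nat \<Rightarrow> (nat \<times> 'n::finite) set \<Rightarrow> (nat \<Rightarrow> nat) \<Rightarrow> 'n set \<Rightarrow> nat" where
  "cover_weight m E k S = (\<Sum>j\<in>{j \<in> {1..m}. nbrs E j \<inter> S \<noteq> {}}. k j)"

definition covered :: "nat \<Rightarrow> (nat \<times> 'n::finite) set \<Rightarrow> (nat \<Rightarrow> nat) \<Rightarrow> 'n set" where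
  "covered m E k = (\<Union>j\<in>{j \<in> {1..m}. 0 < k j}. nbrs E j)"

lemma cover_weight_if:
  "cover_weight m E k S = (\<Sum>j=1..m. if nbrs E j \<inter> S \<noteq> {} then k j else 0)"
  unfolding cover_weight_def by (rule sum.inter_filter) simp

lemma cover_weight_covered: "cover_weight m E k (S \<inter> covered m E k) = cover_weight m E k S"
  unfolding cover_weight_if
proof (intro sum.cong refl)
  fix j assume j: "j \<in> {1..m}"
  show "(if nbrs E j \<inter> (S \<inter> covered m E k) \<noteq> {} then k j else 0) =
      (if nbrs E j \<inter> S \<noteq> {} then k j else 0)"
  proof (cases "k j = 0")
    case False
    then have "nbrs E j \<subseteq> covered m E k" using j by (auto simp: covered_def)
    then have "nbrs E j \<inter> (S \<inter> covered m E k) = nbrs E j \<inter> S" by blast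
    then show ?thesis by simp
  qed simp
qed

lemma cover_weight_pos:
  assumes "i \<in> covered m E k" "i \<in> S"
  shows "1 \<le> cover_weight m E k S"
proof -
  obtain j where j: "j \<in> {1..m}" "0 < k j" "i \<in> nbrs E j" using assms by (auto simp: covered_def)
  then have "k j \<le> cover_weight m E k S"
    unfolding cover_weight_def using assms(2) by (intro member_le_sum) auto
  then show ?thesis using j by linarith
qed

section \<open>Description of the polytope by inequalities\<close>

lemma convex_cross_polytope: "convex (cross_polytope I)"
  by (simp add: cross_polytope_def)

lemma compact_cross_polytope: "compact (cross_polytope I)"
  by (auto simp: cross_polytope_def intro!: finite_imp_compact_convex_hull)

text \<open>The inequality cuts out a convex set that contains all the vertices.\<close>

lemma cross_polytope_sum_le:
  assumes "y \<in> cross_polytope I"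
  shows "(\<Sum>i\<in>S. \<bar>y $ i\<bar>) \<le> of_bool (I \<inter> S \<noteq> {})"
proof (cases "I = {}")
  case True
  then show ?thesis using assms by (simp add: cross_polytope_def)
next
  case False
  let ?H = "{y :: real ^ 'a. (\<Sum>i\<in>S. \<bar>y $ i\<bar>) \<le> of_bool (I \<inter> S \<noteq> {})}"
  have "convex ?H"
  proof (rule convexI)
    fix x y :: "real ^ 'a" and u v :: real
    assume x: "x \<in> ?H" and y: "y \<in> ?H" and u: "0 \<le> u" and v: "0 \<le> v" and uv: "u + v = 1"
    have "(\<Sum>i\<in>S. \<bar>(u *\<^sub>R x + v *\<^sub>R y) $ i\<bar>) \<le> (\<Sum>i\<in>S. u * \<bar>x $ i\<bar> + v * \<bar>y $ i\<bar>)"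
    proof (rule sum_mono)
      fix i
      show "\<bar>(u *\<^sub>R x + v *\<^sub>R y) $ i\<bar> \<le> u * \<bar>x $ i\<bar> + v * \<bar>y $ i\<bar>"
        using abs_triangle_ineq[of "u * x $ i" "v * y $ i"] u v by (simp add: abs_mult)
    qed
    also have "\<dots> = u * (\<Sum>i\<in>S. \<bar>x $ i\<bar>) + v * (\<Sum>i\<in>S. \<bar>y $ i\<bar>)"
      by (simp add: sum.distrib sum_distrib_left)
    also have "\<dots> \<le> u * of_bool (I \<inter> S \<noteq> {}) + v * of_bool (I \<inter> S \<noteq> {})"
      using x y u v by (intro add_mono mult_left_mono) auto
    also have "\<dots> = of_bool (I \<inter> S \<noteq> {})" using uv by (simp add: distrib_right[symmetric])
    finally show "u *\<^sub>R x + v *\<^sub>R y \<in> ?H" by simp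
  qed
  moreover have "(\<Union>i\<in>I. {axis i 1, - axis i 1}) \<subseteq> ?H"
  proof
    fix y :: "real ^ 'a" assume "y \<in> (\<Union>i\<in>I. {axis i 1, - axis i 1})"
    then obtain i where i: "i \<in> I" "\<And>l. \<bar>y $ l\<bar> = (if l = i then 1 else 0)"
      by (auto simp: axis_def)
    then have "(\<Sum>l\<in>S. \<bar>y $ l\<bar>) = (if i \<in> S then 1 else 0)" by simp
    then show "y \<in> ?H" using i(1) by auto
  qed
  ultimately have "convex hull (\<Union>i\<in>I. {axis i 1, - axis i 1}) \<subseteq> ?H" by (intro hull_minimal)
  moreover have "y \<in> convex hull (\<Union>i\<in>I. {axis i 1, - axis i 1})"
    using assms False by (simp add: cross_polytope_def)
  ultimately have "y \<in> ?H" by blast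
  then show ?thesis by (rule CollectD)
qed

lemma Q_polytope_alt:
  "Q_polytope m E k = {(\<Sum>j=1..m. real (k j) *\<^sub>R p j) |p. \<forall>j\<in>{1..m}. p j \<in> cross_polytope (nbrs E j)}"
proof (intro equalityI subsetI)
  fix x assume "x \<in> Q_polytope m E k"
  then obtain s where x: "x = sum s {1..m}"
    and s: "\<forall>j\<in>{1..m}. s j \<in> (\<lambda>x. real (k j) *\<^sub>R x) ` cross_polytope (nbrs E j)"
    unfolding Q_polytope_def set_sum_alt[OF finite_atLeastAtMost] by blast
  then have "\<forall>j\<in>{1..m}. \<exists>p. p \<in> cross_polytope (nbrs E j) \<and> s j = real (k j) *\<^sub>R p" by blast
  then obtain p where "\<forall>j\<in>{1..m}. p j \<in> cross_polytope (nbrs E j) \<and> s j = real (k j) *\<^sub>R p j" by metis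
  then show "x \<in> {(\<Sum>j=1..m. real (k j) *\<^sub>R p j) |p. \<forall>j\<in>{1..m}. p j \<in> cross_polytope (nbrs E j)}"
    using x by auto
next
  fix x assume "x \<in> {(\<Sum>j=1..m. real (k j) *\<^sub>R p j) |p. \<forall>j\<in>{1..m}. p j \<in> cross_polytope (nbrs E j)}"
  then show "x \<in> Q_polytope m E k"
    unfolding Q_polytope_def set_sum_alt[OF finite_atLeastAtMost] by blast
qed

lemma convex_Q_polytope: "convex (Q_polytope m E k)"
  unfolding Q_polytope_def by (intro convex_set_sum convex_scaling convex_cross_polytope)

lemma compact_set_plus:
  fixes A B :: "'a::real_normed_vector set"
  assumes "compact A" "compact B"
  shows "compact (A + B)"
proof -
  have "A + B = {x + y |x y. x \<in> A \<and> y \<in> B}" by (auto simp: set_plus_def)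
  then show ?thesis using compact_sums[OF assms] by simp
qed

lemma compact_set_sum:
  fixes A :: "'i \<Rightarrow> 'a::real_normed_vector set"
  assumes "\<And>i. i \<in> I \<Longrightarrow> compact (A i)"
  shows "compact (\<Sum>i\<in>I. A i)"
  using assms by (induction I rule: infinite_finite_induct) (auto simp: compact_set_plus set_zero)

lemma closed_Q_polytope: "closed (Q_polytope m E k)"
  unfolding Q_polytope_def
  by (intro compact_imp_closed compact_set_sum compact_scaling compact_cross_polytope)

text \<open>Peels off the level sets of \<open>w\<close>, starting from its support.\<close>

lemma weighted_sum_le_cover:
  fixes w y :: "'n::finite \<Rightarrow> real" and M :: "nat \<Rightarrow> real"
  assumes "\<And>S. sum y S \<le> real (cover_weight m E k S)"
    and "\<And>i. 0 \<le> w i" and "\<And>j. 0 \<le> M j" and "\<And>i j. i \<in> nbrs E j \<Longrightarrow> w i \<le> M j"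
  shows "(\<Sum>i\<in>UNIV. w i * y i) \<le> (\<Sum>j=1..m. real (k j) * M j)"
  using assms(2-)
proof (induction "card {i. 0 < w i}" arbitrary: w M rule: less_induct)
  case less
  let ?S = "{i. 0 < w i}"
  show ?case
  proof (cases "?S = {}")
    case True
    then have "w i = 0" for i using less.prems(1)[of i] by (auto simp: not_less intro: antisym)
    then show ?thesis using less.prems(2) by (simp add: sum_nonneg)
  next
    case False
    \<comment> \<open>The least positive value of \<open>w\<close>: subtracting it on the support
      keeps \<open>w\<close> nonnegative and shrinks the support. \<open>M\<close> is lowered by the
      same amount exactly where the neighbourhood meets the support.\<close>
    define \<epsilon> where "\<epsilon> = Min (w ` ?S)"
    have "\<epsilon> \<in> w ` ?S" unfolding \<epsilon>_def using False by (intro Min_in) auto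
    then obtain i0 where i0: "w i0 = \<epsilon>" "0 < \<epsilon>" by auto
    have le: "\<epsilon> \<le> w i" if "0 < w i" for i unfolding \<epsilon>_def using that by (intro Min_le) auto
    define w' where "w' i = w i - \<epsilon> * of_bool (0 < w i)" for i
    define M' where "M' j = M j - \<epsilon> * of_bool (nbrs E j \<inter> ?S \<noteq> {})" for j
    have "card {i. 0 < w' i} < card ?S"
    proof (rule psubset_card_mono)
      have "{i. 0 < w' i} \<subseteq> ?S" using less.prems(1) by (auto simp: w'_def of_bool_def split: if_splits)
      moreover have "i0 \<in> ?S" "i0 \<notin> {i. 0 < w' i}" using i0 by (auto simp: w'_def)
      ultimately show "{i. 0 < w' i} \<subset> ?S" by blast
    qed simp
    moreover have "0 \<le> w' i" for i
      using le[of i] less.prems(1)[of i] by (auto simp: w'_def)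
    moreover have "0 \<le> M' j" for j
    proof (cases "nbrs E j \<inter> ?S = {}")
      case True
      then show ?thesis using less.prems(2)[of j] by (simp add: M'_def)
    next
      case False
      then obtain i where "i \<in> nbrs E j" "0 < w i" by auto
      then have "\<epsilon> \<le> M j" using le[of i] less.prems(3)[of i j] by linarith
      then show ?thesis using False by (simp add: M'_def)
    qed
    moreover have "w' i \<le> M' j" if "i \<in> nbrs E j" for i j
    proof (cases "0 < w i")
      case True
      then have "nbrs E j \<inter> ?S \<noteq> {}" using that by auto
      then show ?thesis using True less.prems(3)[OF that] by (simp add: w'_def M'_def)
    next
      case False
      then have "w' i = 0" using less.prems(1)[of i] by (simp add: w'_def)
      then show ?thesis using \<open>\<And>j. 0 \<le> M' j\<close> by simp
    qed
    ultimately have IH: "(\<Sum>i\<in>UNIV. w' i * y i) \<le> (\<Sum>j=1..m. real (k j) * M' j)"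
      by (rule less.hyps)
    have "(\<Sum>i\<in>UNIV. w i * y i) = (\<Sum>i\<in>UNIV. w' i * y i + \<epsilon> * (of_bool (0 < w i) * y i))"
      by (intro sum.cong refl) (simp add: w'_def algebra_simps)
    also have "\<dots> = (\<Sum>i\<in>UNIV. w' i * y i) + \<epsilon> * (\<Sum>i\<in>UNIV. of_bool (0 < w i) * y i)"
      by (simp only: sum.distrib sum_distrib_left)
    also have "(\<Sum>i\<in>UNIV. of_bool (0 < w i) * y i) = sum y ?S"
      by (rule sum.mono_neutral_cong_right) auto
    also have "(\<Sum>i\<in>UNIV. w' i * y i) + \<epsilon> * sum y ?S \<le>
        (\<Sum>j=1..m. real (k j) * M' j) + \<epsilon> * real (cover_weight m E k ?S)"
      using IH assms(1) i0 by (intro add_mono mult_left_mono) auto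
    also have "real (cover_weight m E k ?S) = (\<Sum>j=1..m. real (k j) * of_bool (nbrs E j \<inter> ?S \<noteq> {}))"
      unfolding cover_weight_if of_nat_sum by (intro sum.cong) auto
    also have "(\<Sum>j=1..m. real (k j) * M' j) +
        \<epsilon> * (\<Sum>j=1..m. real (k j) * of_bool (nbrs E j \<inter> ?S \<noteq> {})) = (\<Sum>j=1..m. real (k j) * M j)"
      unfolding sum_distrib_left sum.distrib[symmetric]
      by (intro sum.cong refl) (simp add: M'_def algebra_simps)
    finally show ?thesis .
  qed
qed

text \<open>Necessity adds up the bounds for the cross-polytopes. For sufficiency a point outside is
  separated by some \<open>v\<close>, whose minimum on the polytope is minus the sum of
  \<open>k j * M j\<close>, where \<open>M j\<close> is the largest absolute value of
  \<open>v\<close> on the neighbours of \<open>j\<close>. The inequalities bound the inner product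
  of \<open>v\<close> and \<open>x\<close> from below by that minimum.\<close>

theorem mem_Q_polytope:
  fixes E :: "(nat \<times> 'n::finite) set"
  shows "x \<in> Q_polytope m E k \<longleftrightarrow> (\<forall>S. (\<Sum>i\<in>S. \<bar>x $ i\<bar>) \<le> real (cover_weight m E k S))"
proof (intro iffI allI)
  fix S assume "x \<in> Q_polytope m E k"
  then obtain p where x: "x = (\<Sum>j=1..m. real (k j) *\<^sub>R p j)"
    and p: "\<forall>j\<in>{1..m}. p j \<in> cross_polytope (nbrs E j)"
    unfolding Q_polytope_alt by blast
  have "(\<Sum>i\<in>S. \<bar>x $ i\<bar>) \<le> (\<Sum>i\<in>S. \<Sum>j=1..m. real (k j) * \<bar>p j $ i\<bar>)"
    unfolding x by (intro sum_mono) (auto simp: abs_mult intro: order_trans[OF sum_abs])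
  also have "\<dots> = (\<Sum>j=1..m. real (k j) * (\<Sum>i\<in>S. \<bar>p j $ i\<bar>))"
    unfolding sum_distrib_left by (rule sum.swap)
  also have "\<dots> \<le> (\<Sum>j=1..m. real (k j) * of_bool (nbrs E j \<inter> S \<noteq> {}))"
    using p by (intro sum_mono mult_left_mono cross_polytope_sum_le) auto
  also have "\<dots> = real (cover_weight m E k S)"
    unfolding cover_weight_if of_nat_sum by (intro sum.cong) auto
  finally show "(\<Sum>i\<in>S. \<bar>x $ i\<bar>) \<le> real (cover_weight m E k S)" .
next
  assume x: "\<forall>S. (\<Sum>i\<in>S. \<bar>x $ i\<bar>) \<le> real (cover_weight m E k S)"
  show "x \<in> Q_polytope m E k"
  proof (rule ccontr)
    assume "x \<notin> Q_polytope m E k"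
    then obtain v b where vx: "v \<bullet> x < b" and vQ: "\<forall>y\<in>Q_polytope m E k. b < v \<bullet> y"
      using separating_hyperplane_closed_point[OF convex_Q_polytope closed_Q_polytope] by blast
    \<comment> \<open>The value 0 for an isolated vertex fits its cross-polytope
      \<open>{0}\<close>.\<close>
    define M where "M j = (if nbrs E j = {} then 0 else Max ((\<lambda>i. \<bar>v $ i\<bar>) ` nbrs E j))" for j
    have Mle: "\<bar>v $ i\<bar> \<le> M j" if "i \<in> nbrs E j" for i j
      using that by (auto simp: M_def)
    have M0: "0 \<le> M j" for j
    proof (cases "nbrs E j = {}")
      case False
      then obtain i where "i \<in> nbrs E j" by blast
      from Mle[OF this] show ?thesis by linarith
    qed (simp add: M_def)
    have "\<exists>p\<in>cross_polytope (nbrs E j). v \<bullet> p = - M j" for j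
    proof (cases "nbrs E j = {}")
      case True
      then show ?thesis by (simp add: cross_polytope_def M_def)
    next
      case False
      then have "M j \<in> (\<lambda>i. \<bar>v $ i\<bar>) ` nbrs E j" unfolding M_def by (auto intro!: Max_in)
      then obtain i where i: "i \<in> nbrs E j" "M j = \<bar>v $ i\<bar>" by blast
      \<comment> \<open>The vertex at which \<open>v\<close> attains its minimum on the
        cross-polytope.\<close>
      let ?p = "if 0 \<le> v $ i then - axis i 1 else axis i 1 :: real ^ 'n"
      have "?p \<in> cross_polytope (nbrs E j)"
        using i(1) False unfolding cross_polytope_def by (auto intro!: hull_inc)
      moreover have "v \<bullet> ?p = - M j" by (simp add: i(2) inner_axis)
      ultimately show ?thesis by blast
    qed
    then obtain p where p: "\<And>j. p j \<in> cross_polytope (nbrs E j)" "\<And>j. v \<bullet> p j = - M j" by metis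
    have "(\<Sum>j=1..m. real (k j) *\<^sub>R p j) \<in> Q_polytope m E k"
      unfolding Q_polytope_alt using p by blast
    then have "b < v \<bullet> (\<Sum>j=1..m. real (k j) *\<^sub>R p j)" using vQ by blast
    also have "\<dots> = - (\<Sum>j=1..m. real (k j) * M j)"
      by (simp add: inner_sum_right p sum_negf)
    finally have "(\<Sum>j=1..m. real (k j) * M j) < - b" by simp
    moreover have "(\<Sum>i\<in>UNIV. \<bar>v $ i\<bar> * \<bar>x $ i\<bar>) \<le> (\<Sum>j=1..m. real (k j) * M j)"
      using x M0 Mle by (intro weighted_sum_le_cover) auto
    moreover have "- (v \<bullet> x) \<le> (\<Sum>i\<in>UNIV. \<bar>v $ i\<bar> * \<bar>x $ i\<bar>)"
    proof -
      have "- (v \<bullet> x) = (\<Sum>i\<in>UNIV. - (v $ i * x $ i))"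
        by (simp add: inner_vec_def sum_negf)
      also have "\<dots> \<le> (\<Sum>i\<in>UNIV. \<bar>v $ i\<bar> * \<bar>x $ i\<bar>)"
        by (intro sum_mono) (simp add: abs_mult[symmetric])
      finally show ?thesis .
    qed
    ultimately show False using vx by linarith
  qed
qed

section \<open>Affine hull, dimension and relative interior\<close>

lemma Q_polytope_support:
  assumes "x \<in> Q_polytope m E k" "i \<notin> covered m E k"
  shows "x $ i = 0"
proof -
  have "cover_weight m E k {i} = cover_weight m E k ({i} \<inter> covered m E k)"
    by (rule cover_weight_covered[symmetric])
  also have "\<dots> = 0" using assms(2) by (simp add: cover_weight_def)
  finally show ?thesis using assms(1) mem_Q_polytope[of x m E k] by (auto dest: spec[of _ "{i}"])
qed

lemma zero_in_Q_polytope: "0 \<in> Q_polytope m E k"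
  by (simp add: mem_Q_polytope)

lemma axis_in_Q_polytope:
  assumes "i \<in> covered m E k"
  shows "axis i 1 \<in> Q_polytope m E k"
  unfolding mem_Q_polytope
proof
  fix S
  have "(\<Sum>l\<in>S. \<bar>(axis i 1 :: real ^ 'a) $ l\<bar>) = (\<Sum>l\<in>S. if l = i then 1 else 0)"
    by (intro sum.cong) (auto simp: axis_def)
  also have "\<dots> = (if i \<in> S then 1 else 0)" by simp
  also have "\<dots> \<le> real (cover_weight m E k S)" using cover_weight_pos[OF assms, of S] by auto
  finally show "(\<Sum>l\<in>S. \<bar>(axis i 1 :: real ^ 'a) $ l\<bar>) \<le> real (cover_weight m E k S)" .
qed

lemma subspace_supported: "subspace {x :: real ^ 'n. \<forall>i. i \<notin> I \<longrightarrow> x $ i = 0}"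
  by (auto simp: subspace_def)

lemma span_Q_polytope:
  "span (Q_polytope m E k) = {x :: real ^ 'n. \<forall>i. i \<notin> covered m E k \<longrightarrow> x $ i = 0}"
proof
  show "span (Q_polytope m E k) \<subseteq> {x. \<forall>i. i \<notin> covered m E k \<longrightarrow> x $ i = 0}"
    by (intro span_minimal subspace_supported) (auto dest: Q_polytope_support)
  show "{x. \<forall>i. i \<notin> covered m E k \<longrightarrow> x $ i = 0} \<subseteq> span (Q_polytope m E k)"
  proof
    fix x assume x: "x \<in> {x :: real ^ 'n. \<forall>i. i \<notin> covered m E k \<longrightarrow> x $ i = 0}"
    have "(\<Sum>i\<in>UNIV. x $ i *\<^sub>R axis i 1) \<in> span (Q_polytope m E k)"
    proof (rule span_sum)
      fix i
      show "x $ i *\<^sub>R axis i 1 \<in> span (Q_polytope m E k)"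
      proof (cases "i \<in> covered m E k")
        case True
        then show ?thesis by (intro span_mul span_base axis_in_Q_polytope)
      next
        case False
        then show ?thesis using x by (simp add: span_zero)
      qed
    qed
    then show "x \<in> span (Q_polytope m E k)"
      using basis_expansion[of x] by (simp add: scalar_mult_eq_scaleR)
  qed
qed

lemma affine_hull_Q_polytope:
  "affine hull (Q_polytope m E k) = {x :: real ^ 'n. \<forall>i. i \<notin> covered m E k \<longrightarrow> x $ i = 0}"
  using affine_hull_span_0[of "Q_polytope m E k"] zero_in_Q_polytope[of m E k]
  by (simp add: hull_inc span_Q_polytope)

lemma aff_dim_Q_polytope: "aff_dim (Q_polytope m E k) = int (card (covered m E k))"
proof -
  have "aff_dim (Q_polytope m E k) = int (dim (Q_polytope m E k))"
    using zero_in_Q_polytope by (intro aff_dim_zero hull_inc)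
  also have "dim (Q_polytope m E k) = dim (span (Q_polytope m E k))" by simp
  also have "\<dots> = card (covered m E k)"
    unfolding span_Q_polytope dim_vec_eq[symmetric] by (rule dim_substandard_cart)
  finally show ?thesis .
qed

text \<open>An equality for \<open>S\<close> is broken by pushing one coordinate in \<open>S\<close>
  away from 0 within the affine hull. Conversely, finitely many strict inequalities have a common
  positive gap, which leaves room for a small ball in the affine hull.\<close>

theorem mem_rel_interior_Q_polytope:
  "x \<in> rel_interior (Q_polytope m E k) \<longleftrightarrow> x \<in> Q_polytope m E k \<and>
    (\<forall>S. S \<subseteq> covered m E k \<and> S \<noteq> {} \<longrightarrow> (\<Sum>i\<in>S. \<bar>x $ i\<bar>) < real (cover_weight m E k S))"
proof (intro iffI conjI allI impI)
  assume x: "x \<in> rel_interior (Q_polytope m E k)"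
  then show xQ: "x \<in> Q_polytope m E k" using rel_interior_subset by blast
  fix S assume S: "S \<subseteq> covered m E k \<and> S \<noteq> {}"
  then obtain i where i: "i \<in> S" by blast
  obtain \<epsilon> where \<epsilon>: "0 < \<epsilon>" "cball x \<epsilon> \<inter> affine hull Q_polytope m E k \<subseteq> Q_polytope m E k"
    using x unfolding mem_rel_interior_cball by blast
  \<comment> \<open>The sign makes the absolute value of coordinate \<open>i\<close> grow by exactly
    \<open>\<epsilon>\<close>.\<close>
  define s :: real where "s = (if 0 \<le> x $ i then \<epsilon> else - \<epsilon>)"
  define y where "y = x + s *\<^sub>R axis i 1"
  have y: "y $ l = x $ l + (if l = i then s else 0)" for l by (simp add: y_def axis_def)
  have "y \<in> cball x \<epsilon>" using \<epsilon>(1) by (simp add: y_def dist_norm s_def)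
  moreover have "y \<in> affine hull Q_polytope m E k"
    unfolding affine_hull_Q_polytope using i S Q_polytope_support[OF xQ] by (auto simp: y)
  ultimately have "y \<in> Q_polytope m E k" using \<epsilon>(2) by blast
  then have "(\<Sum>l\<in>S. \<bar>y $ l\<bar>) \<le> real (cover_weight m E k S)" by (simp add: mem_Q_polytope)
  moreover have "(\<Sum>l\<in>S. \<bar>y $ l\<bar>) = (\<Sum>l\<in>S. \<bar>x $ l\<bar> + (if l = i then \<epsilon> else 0))"
    using \<epsilon>(1) by (intro sum.cong) (auto simp: y s_def)
  moreover have "\<dots> = (\<Sum>l\<in>S. \<bar>x $ l\<bar>) + \<epsilon>" using i by (simp add: sum.distrib)
  ultimately show "(\<Sum>i\<in>S. \<bar>x $ i\<bar>) < real (cover_weight m E k S)" using \<epsilon>(1) by simp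
next
  let ?C = "covered m E k"
  let ?gap = "\<lambda>S. real (cover_weight m E k S) - (\<Sum>i\<in>S. \<bar>x $ i\<bar>)"
  assume "x \<in> Q_polytope m E k \<and>
    (\<forall>S. S \<subseteq> ?C \<and> S \<noteq> {} \<longrightarrow> (\<Sum>i\<in>S. \<bar>x $ i\<bar>) < real (cover_weight m E k S))"
  then have xQ: "x \<in> Q_polytope m E k" and gap: "\<And>S. S \<subseteq> ?C \<Longrightarrow> S \<noteq> {} \<Longrightarrow> 0 < ?gap S" by auto
  \<comment> \<open>The inserted 1 keeps the minimum meaningful when \<open>?C\<close> is
    empty.\<close>
  define \<delta> where "\<delta> = Min (insert 1 (?gap ` (Pow ?C - {{}})))"
  have \<delta>0: "0 < \<delta>" unfolding \<delta>_def using gap by (subst Min_gr_iff) auto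
  have \<delta>le: "\<delta> \<le> ?gap S" if "S \<subseteq> ?C" "S \<noteq> {}" for S
    unfolding \<delta>_def using that by (intro Min_le) auto
  \<comment> \<open>Each coordinate moves by at most \<open>\<epsilon>\<close>, so the sum over any
    set grows by less than \<open>\<delta>\<close>.\<close>
  define \<epsilon> where "\<epsilon> = \<delta> / (real CARD('a) + 1)"
  have "cball x \<epsilon> \<inter> affine hull Q_polytope m E k \<subseteq> Q_polytope m E k"
  proof
    fix y assume y: "y \<in> cball x \<epsilon> \<inter> affine hull Q_polytope m E k"
    have near: "\<bar>y $ i\<bar> \<le> \<bar>x $ i\<bar> + \<epsilon>" for i
    proof -
      have "\<bar>(y - x) $ i\<bar> \<le> norm (y - x)" by (rule component_le_norm_cart)
      also have "\<dots> \<le> \<epsilon>" using y by (simp add: dist_norm norm_minus_commute)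
      finally show ?thesis by simp
    qed
    show "y \<in> Q_polytope m E k"
      unfolding mem_Q_polytope
    proof
      fix S
      have "(\<Sum>i\<in>S. \<bar>y $ i\<bar>) = (\<Sum>i\<in>S \<inter> ?C. \<bar>y $ i\<bar>)"
        using y by (intro sum.mono_neutral_right) (auto simp: affine_hull_Q_polytope)
      also have "\<dots> \<le> real (cover_weight m E k (S \<inter> ?C))"
      proof (cases "S \<inter> ?C = {}")
        case False
        have "(\<Sum>i\<in>S \<inter> ?C. \<bar>y $ i\<bar>) \<le> (\<Sum>i\<in>S \<inter> ?C. \<bar>x $ i\<bar> + \<epsilon>)" using near by (intro sum_mono)
        also have "\<dots> = (\<Sum>i\<in>S \<inter> ?C. \<bar>x $ i\<bar>) + real (card (S \<inter> ?C)) * \<epsilon>" by (simp add: sum.distrib)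
        also have "real (card (S \<inter> ?C)) * \<epsilon> \<le> (real CARD('a) + 1) * \<epsilon>"
          using \<delta>0 card_mono[of "UNIV :: 'a set" "S \<inter> ?C"]
          by (intro mult_right_mono) (auto simp: \<epsilon>_def)
        also have "(real CARD('a) + 1) * \<epsilon> = \<delta>" by (simp add: \<epsilon>_def)
        also have "(\<Sum>i\<in>S \<inter> ?C. \<bar>x $ i\<bar>) + \<delta> \<le> real (cover_weight m E k (S \<inter> ?C))"
          using \<delta>le[of "S \<inter> ?C"] False by simp
        finally show ?thesis by simp
      qed simp
      finally show "(\<Sum>i\<in>S. \<bar>y $ i\<bar>) \<le> real (cover_weight m E k S)"
        by (simp add: cover_weight_covered)
    qed
  qed
  moreover have "0 < \<epsilon>" using \<delta>0 by (simp add: \<epsilon>_def)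
  ultimately show "x \<in> rel_interior (Q_polytope m E k)"
    using xQ unfolding mem_rel_interior_cball by blast
qed

section \<open>Counting lattice points\<close>

definition abs_nat :: "real ^ 'n::finite \<Rightarrow> 'n \<Rightarrow> nat" where
  "abs_nat x i = nat \<lfloor>\<bar>x $ i\<bar>\<rfloor>"

lemma of_nat_abs_nat:
  assumes "x $ i \<in> \<int>"
  shows "real (abs_nat x i) = \<bar>x $ i\<bar>"
  using assms by (auto simp: abs_nat_def elim!: Ints_cases)

lemma prod_if_zero_one_two:
  assumes "finite R"
  shows "(\<Prod>r\<in>R. if b r = (0::nat) then 1 else 2 :: 'c::comm_semiring_1) = 2 ^ card {r \<in> R. 0 < b r}"
proof -
  have "(\<Prod>r\<in>R. if b r = 0 then 1 else 2 :: 'c) = (\<Prod>r\<in>{r \<in> R. 0 < b r}. 2)"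
    using assms by (intro prod.mono_neutral_cong_right) auto
  then show ?thesis by simp
qed

text \<open>Each nonzero coordinate admits two signs; for a zero coordinate the two-element list of
  values collapses to one.\<close>

lemma lattice_fibre:
  fixes b :: "'n::finite \<Rightarrow> nat"
  defines "X \<equiv> {x :: real ^ 'n. (\<forall>i. x $ i \<in> \<int>) \<and> abs_nat x = b}"
  shows "finite X" and "card X = 2 ^ card {i. 0 < b i}"
proof -
  let ?F = "PiE UNIV (\<lambda>i. {real (b i), - real (b i)})"
  have "X = vec_lambda ` ?F"
  proof (intro equalityI subsetI)
    fix x assume x: "x \<in> X"
    have "x $ i \<in> {real (b i), - real (b i)}" for i
      using x of_nat_abs_nat[of x i] by (auto simp: X_def abs_if split: if_splits)
    then have "vec_nth x \<in> ?F" by auto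
    then show "x \<in> vec_lambda ` ?F" by (intro image_eqI[of _ _ "vec_nth x"]) auto
  next
    fix x assume "x \<in> vec_lambda ` ?F"
    then have x: "x $ i = real (b i) \<or> x $ i = - real (b i)" for i by auto
    have "x $ i \<in> \<int>" "abs_nat x i = b i" for i using x[of i] by (auto simp: abs_nat_def)
    then show "x \<in> X" by (auto simp: X_def)
  qed
  moreover have "inj_on vec_lambda ?F" by (auto simp: inj_on_def vec_lambda_inject)
  moreover have "finite ?F" by (intro finite_PiE) auto
  ultimately have "finite X" "card X = card ?F" by (simp_all add: card_image)
  moreover have "card ?F = (\<Prod>i\<in>UNIV. if b i = 0 then 1 else 2)"
    by (subst card_PiE) (auto intro!: prod.cong simp: card_insert_if)
  ultimately show "finite X" "card X = 2 ^ card {i. 0 < b i}"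
    using prod_if_zero_one_two[of UNIV b, where 'c = nat] by auto
qed

lemma lattice_preimage:
  fixes B :: "('n::finite \<Rightarrow> nat) set"
  assumes "finite B"
  defines "X \<equiv> {x :: real ^ 'n. (\<forall>i. x $ i \<in> \<int>) \<and> abs_nat x \<in> B}"
  shows "finite X" and "card X = (\<Sum>b\<in>B. 2 ^ card {i. 0 < b i})"
proof -
  let ?X = "\<lambda>b. {x :: real ^ 'n. (\<forall>i. x $ i \<in> \<int>) \<and> abs_nat x = b}"
  have X: "X = (\<Union>b\<in>B. ?X b)" by (auto simp: X_def)
  show "finite X" unfolding X using assms(1) lattice_fibre(1) by blast
  have "card X = (\<Sum>b\<in>B. card (?X b))"
    unfolding X using assms(1) lattice_fibre(1) by (intro card_UN_disjoint) auto
  then show "card X = (\<Sum>b\<in>B. 2 ^ card {i. 0 < b i})" by (simp add: lattice_fibre(2))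
qed

lemma card_nb_copies:
  "card (nb (copy_edges E) (copies {1..m} k) S) = cover_weight m E k S"
proof -
  have "nb (copy_edges E) (copies {1..m} k) S = Sigma {j \<in> {1..m}. nbrs E j \<inter> S \<noteq> {}} (\<lambda>j. {..<k j})"
    by (auto simp: nb_def copy_edges_def copies_def nbrs_def)
  then show ?thesis by (simp add: card_SigmaI cover_weight_def)
qed

lemma lattice_point_Q_polytope:
  fixes x :: "real ^ 'n::finite"
  assumes x: "\<forall>i. x $ i \<in> \<int>"
  shows "x \<in> Q_polytope m E k \<longleftrightarrow>
    abs_nat x \<in> draconians (copy_edges E) (copies {1..m} k) (covered m E k)"
proof -
  let ?C = "covered m E k"
  have sum: "(\<Sum>i\<in>S. \<bar>x $ i\<bar>) = real (sum (abs_nat x) S)" for S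
    using x of_nat_abs_nat[of x] by simp
  show ?thesis
  proof
    assume Q: "x \<in> Q_polytope m E k"
    show "abs_nat x \<in> draconians (copy_edges E) (copies {1..m} k) ?C"
    proof (rule draconiansI)
      fix i assume "i \<notin> ?C"
      then show "abs_nat x i = 0" using Q_polytope_support[OF Q] by (simp add: abs_nat_def)
    next
      fix S
      show "sum (abs_nat x) S \<le> card (nb (copy_edges E) (copies {1..m} k) S)"
        using Q sum[of S] unfolding mem_Q_polytope card_nb_copies by (metis of_nat_le_iff)
    qed
  next
    assume D: "abs_nat x \<in> draconians (copy_edges E) (copies {1..m} k) ?C"
    show "x \<in> Q_polytope m E k"
      unfolding mem_Q_polytope
    proof
      fix S
      have "sum (abs_nat x) S = sum (abs_nat x) (S \<inter> ?C)"
        using draconiansD(1)[OF D] by (intro sum_restrict_support) auto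
      also have "\<dots> \<le> cover_weight m E k (S \<inter> ?C)"
        using draconiansD(2)[OF D, of "S \<inter> ?C"] unfolding card_nb_copies by simp
      finally have "sum (abs_nat x) S \<le> cover_weight m E k S" unfolding cover_weight_covered .
      then show "(\<Sum>i\<in>S. \<bar>x $ i\<bar>) \<le> real (cover_weight m E k S)"
        unfolding sum of_nat_le_iff .
    qed
  qed
qed

lemma lattice_point_rel_interior_Q_polytope:
  fixes x :: "real ^ 'n::finite"
  assumes x: "\<forall>i. x $ i \<in> \<int>"
  shows "x \<in> rel_interior (Q_polytope m E k) \<longleftrightarrow>
    abs_nat x \<in> strict_draconians (copy_edges E) (copies {1..m} k) (covered m E k)"
proof -
  let ?C = "covered m E k" and ?E = "copy_edges E" and ?L = "copies {1..m} k"
  have sum: "(\<Sum>i\<in>S. \<bar>x $ i\<bar>) = real (sum (abs_nat x) S)" for S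
    using x of_nat_abs_nat[of x] by simp
  have "abs_nat x \<in> strict_draconians ?E ?L ?C \<longleftrightarrow> abs_nat x \<in> draconians ?E ?L ?C \<and>
      (\<forall>S. S \<subseteq> ?C \<and> S \<noteq> {} \<longrightarrow> sum (abs_nat x) S < cover_weight m E k S)"
  proof (intro iffI conjI)
    assume S: "abs_nat x \<in> strict_draconians ?E ?L ?C"
    then show "abs_nat x \<in> draconians ?E ?L ?C" using strict_draconians_subset by blast
    show "\<forall>S. S \<subseteq> ?C \<and> S \<noteq> {} \<longrightarrow> sum (abs_nat x) S < cover_weight m E k S"
      using strict_draconiansD(2)[OF S] unfolding card_nb_copies by blast
  next
    assume D: "abs_nat x \<in> draconians ?E ?L ?C \<and>
      (\<forall>S. S \<subseteq> ?C \<and> S \<noteq> {} \<longrightarrow> sum (abs_nat x) S < cover_weight m E k S)"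
    show "abs_nat x \<in> strict_draconians ?E ?L ?C"
    proof (rule strict_draconiansI)
      fix i assume "i \<notin> ?C"
      then show "abs_nat x i = 0" by (rule draconiansD(1)[OF conjunct1[OF D]])
    next
      fix S assume "S \<subseteq> ?C" "S \<noteq> {}"
      then show "sum (abs_nat x) S < card (nb ?E ?L S)" unfolding card_nb_copies using D by blast
    qed
  qed
  then show ?thesis
    unfolding mem_rel_interior_Q_polytope lattice_point_Q_polytope[OF x] sum of_nat_less_iff by simp
qed

section \<open>The numbers \<open>c\<close> as coefficients of a power\<close>

lemma int_lists_abs_sum:
  fixes n k :: nat
  defines "X \<equiv> \<lambda>k n. {xs :: int list. length xs = k \<and> (\<Sum>x\<leftarrow>xs. \<bar>x\<bar>) = int n}"
  shows "finite (X k n)" and "card (X k n) = weight_sum (\<lambda>j. if j = 0 then 1 else 2) k n"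
proof -
  let ?w = "\<lambda>j :: nat. if j = 0 then 1 else 2 :: nat"
  have "finite (X k n) \<and> card (X k n) = weight_sum ?w k n"
  proof (induction k arbitrary: n)
    case 0
    have "X 0 n = (if n = 0 then {[]} else {})" by (auto simp: X_def)
    then show ?case by simp
  next
    case (Suc k)
    \<comment> \<open>Lists whose head has absolute value \<open>j\<close>; there are two such
      heads, or one if \<open>j = 0\<close>.\<close>
    let ?A = "\<lambda>j. (\<lambda>(x, ys). x # ys) ` ({int j, - int j} \<times> X k (n - j))"
    have X: "X (Suc k) n = (\<Union>j\<in>{..n}. ?A j)"
    proof (intro equalityI subsetI)
      fix xs assume "xs \<in> X (Suc k) n"
      then obtain x ys where xs: "xs = x # ys" "length ys = k" "\<bar>x\<bar> + (\<Sum>y\<leftarrow>ys. \<bar>y\<bar>) = int n"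
        by (auto simp: X_def length_Suc_conv)
      have "0 \<le> (\<Sum>y\<leftarrow>ys. \<bar>y\<bar>)" by (intro sum_list_nonneg) auto
      then have "nat \<bar>x\<bar> \<le> n" "ys \<in> X k (n - nat \<bar>x\<bar>)" "x \<in> {int (nat \<bar>x\<bar>), - int (nat \<bar>x\<bar>)}"
        using xs by (auto simp: X_def of_nat_diff)
      then show "xs \<in> (\<Union>j\<in>{..n}. ?A j)" using xs(1) by force
    next
      fix xs assume "xs \<in> (\<Union>j\<in>{..n}. ?A j)"
      then show "xs \<in> X (Suc k) n" by (auto simp: X_def of_nat_diff)
    qed
    have fin: "finite (?A j)" for j using Suc.IH by auto
    have "card (?A j) = ?w j * weight_sum ?w k (n - j)" for j
      using Suc.IH[of "n - j"] by (subst card_image) (auto simp: inj_on_def card_cartesian_product card_insert_if)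
    moreover have "card (X (Suc k) n) = (\<Sum>j\<le>n. card (?A j))"
      unfolding X using fin by (intro card_UN_disjoint) auto
    ultimately show ?case using fin X by (simp add: weight_sum_Suc)
  qed
  then show "finite (X k n)" "card (X k n) = weight_sum ?w k n" by auto
qed

lemma c_eq_weight_sum: "c n k = weight_sum (\<lambda>j. if j = 0 then 1 else 2) k n"
  unfolding c_def by (rule int_lists_abs_sum)

lemma c_one: "c n 1 = (if n = 0 then 1 else 2)"
proof -
  have "c n 1 = (\<Sum>j\<le>n. (if j = 0 then 1 else 2) * of_bool (n - j = 0))"
    by (simp add: c_eq_weight_sum weight_sum_Suc)
  also have "\<dots> = (\<Sum>j\<in>{n}. if j = 0 then 1 else 2)"
    by (intro sum.mono_neutral_cong_right) auto
  finally show ?thesis by simp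
qed

text \<open>Used with \<open>q = 1\<close> for all lattice points and with \<open>q = -1\<close> for
  those of the relative interior.\<close>

lemma sum_draconians_copies_signed:
  fixes q :: int and E :: "(nat \<times> 'n::finite) set"
  shows "(\<Sum>x\<in>draconians ((copy_edges E)\<inverse>) UNIV (copies {1..m} k).
      q ^ sum x (copies {1..m} k) * 2 ^ card {p \<in> copies {1..m} k. 0 < x p}) =
    (\<Sum>a\<in>draconians (E\<inverse>) UNIV {1..m}. q ^ sum a {1..m} * (\<Prod>i=1..m. int (c (a i) (k i))))"
proof -
  let ?w = "\<lambda>j :: nat. if j = 0 then 1 else 2 :: nat" and ?L = "copies {1..m} k"
  have eq: "q ^ sum x ?L * 2 ^ card {p \<in> ?L. 0 < x p} = (\<Prod>p\<in>?L. q ^ x p * of_nat (?w (x p)))" for x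
  proof -
    have "(\<Prod>p\<in>?L. of_nat (?w (x p)) :: int) = (\<Prod>p\<in>?L. if x p = 0 then 1 else 2)"
      by (intro prod.cong) auto
    then show ?thesis by (simp add: prod.distrib power_sum prod_if_zero_one_two)
  qed
  have "(\<Sum>x\<in>draconians ((copy_edges E)\<inverse>) UNIV ?L. q ^ sum x ?L * 2 ^ card {p \<in> ?L. 0 < x p}) =
      (\<Sum>a\<in>draconians (E\<inverse>) UNIV {1..m}. \<Prod>i=1..m. weight_sum (\<lambda>j. q ^ j * of_nat (?w j)) (k i) (a i))"
    unfolding eq by (rule sum_draconians_copies[where w = "\<lambda>j. q ^ j * of_nat (?w j)"]) simp_all
  also have "\<dots> = (\<Sum>a\<in>draconians (E\<inverse>) UNIV {1..m}. q ^ sum a {1..m} * (\<Prod>i=1..m. int (c (a i) (k i))))"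
    by (simp only: weight_sum_hom c_eq_weight_sum[symmetric] prod.distrib power_sum)
  finally show ?thesis .
qed

text \<open>Passes from extensional sequences to functions vanishing outside \<open>{1..m}\<close>.
  The assumption on \<open>g\<close> says that it depends only on the values on
  \<open>{1..m}\<close>.\<close>

lemma sum_draconian:
  fixes g :: "(nat \<Rightarrow> nat) \<Rightarrow> 'c::comm_monoid_add"
  assumes g: "\<And>a. g (restrict a {1..m}) = g a"
  shows "sum g (draconian m E) = sum g (draconians (E\<inverse>) UNIV {1..m})"
proof (rule sum.reindex_bij_witness[of _ "\<lambda>a. restrict a {1..m}" "\<lambda>a i. if i \<in> {1..m} then a i else 0"])
  have nb: "nb (E\<inverse>) UNIV J = (\<Union>i\<in>J. nbrs E i)" for J
    by (auto simp: nb_def nbrs_def)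
  {
    fix a assume a: "a \<in> draconian m E"
    show "restrict (\<lambda>i. if i \<in> {1..m} then a i else 0) {1..m} = a"
      using a by (auto simp: draconian_def PiE_def extensional_def fun_eq_iff)
    show "(\<lambda>i. if i \<in> {1..m} then a i else 0) \<in> draconians (E\<inverse>) UNIV {1..m}"
    proof (rule draconiansI)
      fix J :: "nat set" assume J: "J \<subseteq> {1..m}" "J \<noteq> {}"
      have "(\<Sum>i\<in>J. if i \<in> {1..m} then a i else 0) = sum a J" using J by (intro sum.cong) auto
      then show "(\<Sum>i\<in>J. if i \<in> {1..m} then a i else 0) \<le> card (nb (E\<inverse>) UNIV J)"
        using a J by (simp add: draconian_def nb)
    qed auto
    have "restrict (\<lambda>i. if i \<in> {1..m} then a i else 0) {1..m} = restrict a {1..m}" by auto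
    then show "g (\<lambda>i. if i \<in> {1..m} then a i else 0) = g a"
      using g[of a] g[of "\<lambda>i. if i \<in> {1..m} then a i else 0"] by simp
  next
    fix a assume a: "a \<in> draconians (E\<inverse>) UNIV {1..m}"
    show "(\<lambda>i. if i \<in> {1..m} then restrict a {1..m} i else 0) = a"
      using draconiansD(1)[OF a] by (auto simp: fun_eq_iff)
    have "sum (restrict a {1..m}) J \<le> card (\<Union>i\<in>J. nbrs E i)" if "J \<subseteq> {1..m}" for J
    proof -
      have "sum (restrict a {1..m}) J = sum a J" using that by (intro sum.cong) auto
      then show ?thesis using draconiansD(2)[OF a that] by (simp add: nb)
    qed
    then show "restrict a {1..m} \<in> draconian m E" by (simp add: draconian_def)
  }
qed

section \<open>Assembling the boundary count\<close>

lemma finite_draconian: "finite (draconian m E)"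
proof -
  have "draconian m E \<subseteq> PiE {1..m} (\<lambda>_. {..card (UNIV :: 'a set)})"
  proof
    fix a assume a: "a \<in> draconian m E"
    have "a i \<le> CARD('a)" if "i \<in> {1..m}" for i
    proof -
      have "sum a {i} \<le> card (\<Union>i\<in>{i}. nbrs E i)" using a that unfolding draconian_def by blast
      also have "\<dots> \<le> CARD('a)" by (intro card_mono) auto
      finally show ?thesis by simp
    qed
    then show "a \<in> PiE {1..m} (\<lambda>_. {..CARD('a)})" using a by (auto simp: draconian_def)
  qed
  then show ?thesis by (rule finite_subset) (auto intro!: finite_PiE)
qed

text \<open>All lattice points minus the relatively interior ones; the two counts differ only in the
  sign attached to \<open>a\<close>. Here \<open>card (covered m E k)\<close> is the dimension of
  the polytope.\<close>

theorem card_boundary_lattice_points: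
  fixes E :: "(nat \<times> 'n::finite) set"
  shows "int (card (boundary_lattice_points (Q_polytope m E k))) =
    (\<Sum>a\<in>draconian m E. (1 - (-1) ^ (card (covered m E k) + sum a {1..m})) * (\<Prod>i=1..m. int (c (a i) (k i))))"
proof -
  let ?C = "covered m E k" and ?E = "copy_edges E" and ?L = "copies {1..m} k"
  let ?D = "draconians ?E ?L ?C" and ?S = "strict_draconians ?E ?L ?C"
  let ?pre = "\<lambda>B. {x :: real ^ 'n. (\<forall>i. x $ i \<in> \<int>) \<and> abs_nat x \<in> B}"
  let ?P = "\<lambda>a. \<Prod>i=1..m. int (c (a i) (k i))"
  have finD: "finite ?D" by simp
  have SD: "?S \<subseteq> ?D" by (rule strict_draconians_subset)
  have finS: "finite ?S" by (rule finite_subset[OF SD finD])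
  have supp: "{i. 0 < b i} = {i \<in> ?C. 0 < b i}" if "b \<in> ?D" for b
    using draconiansD(1)[OF that] by (metis (no_types, lifting) less_numeral_extra(3))
  have "boundary_lattice_points (Q_polytope m E k) = ?pre ?D - ?pre ?S"
    using lattice_point_Q_polytope[of _ m E k] lattice_point_rel_interior_Q_polytope[of _ m E k]
    by (auto simp: boundary_lattice_points_def)
  moreover have "?pre ?S \<subseteq> ?pre ?D" using SD by auto
  ultimately have "int (card (boundary_lattice_points (Q_polytope m E k))) =
      int (card (?pre ?D)) - int (card (?pre ?S))"
    using lattice_preimage(1)[OF finD] lattice_preimage(1)[OF finS]
    by (simp add: card_Diff_subset card_mono of_nat_diff)
  also have "int (card (?pre ?D)) = int (\<Sum>b\<in>?D. 2 ^ card {i \<in> ?C. 0 < b i})"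
    unfolding lattice_preimage(2)[OF finD] using supp by (intro arg_cong[of _ _ int] sum.cong) auto
  also have "\<dots> = (\<Sum>x\<in>draconians (?E\<inverse>) ?C ?L. 2 ^ card {p \<in> ?L. 0 < x p})"
    by (subst sum_two_power_draconians) auto
  also have "int (card (?pre ?S)) = (\<Sum>b\<in>?S. 2 ^ card {i \<in> ?C. 0 < b i})"
    unfolding lattice_preimage(2)[OF finS] of_nat_sum using supp SD
    by (intro sum.cong) (auto simp: subset_iff)
  also have "\<dots> = (\<Sum>x\<in>draconians (?E\<inverse>) ?C ?L. (-1) ^ (card ?C + sum x ?L) * 2 ^ card {p \<in> ?L. 0 < x p})"
  proof (rule sum_two_power_strict_draconians)
    fix r assume "r \<in> ?C"
    then have "1 \<le> card (nb ?E ?L {r})" unfolding card_nb_copies by (intro cover_weight_pos) auto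
    then show "nb ?E ?L {r} \<noteq> {}" by auto
  qed auto
  \<comment> \<open>A vertex with a copy has \<open>k j > 0\<close>, so all its neighbours are
    covered.\<close>
  also have "draconians (?E\<inverse>) ?C ?L = draconians (?E\<inverse>) UNIV ?L"
  proof -
    have "nb (?E\<inverse>) UNIV J = nb (?E\<inverse>) ?C J" if "J \<subseteq> ?L" for J
      using that by (force simp: nb_def copy_edges_def copies_def covered_def nbrs_def)
    then show ?thesis by (auto simp: draconians_def)
  qed
  also have "(\<Sum>x\<in>draconians (?E\<inverse>) UNIV ?L. 2 ^ card {p \<in> ?L. 0 < x p}) =
      (\<Sum>a\<in>draconians (E\<inverse>) UNIV {1..m}. ?P a)"
    using sum_draconians_copies_signed[where q = 1 and E = E and m = m and k = k] by simp
  also have "(\<Sum>x\<in>draconians (?E\<inverse>) UNIV ?L. (-1) ^ (card ?C + sum x ?L) * 2 ^ card {p \<in> ?L. 0 < x p}) =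
      (\<Sum>a\<in>draconians (E\<inverse>) UNIV {1..m}. (-1) ^ (card ?C + sum a {1..m}) * ?P a)"
    using sum_draconians_copies_signed[where q = "-1" and E = E and m = m and k = k]
    by (simp add: power_add mult.assoc sum_distrib_left[symmetric])
  also have "(\<Sum>a\<in>draconians (E\<inverse>) UNIV {1..m}. ?P a) -
      (\<Sum>a\<in>draconians (E\<inverse>) UNIV {1..m}. (-1) ^ (card ?C + sum a {1..m}) * ?P a) =
      (\<Sum>a\<in>draconians (E\<inverse>) UNIV {1..m}. (1 - (-1) ^ (card ?C + sum a {1..m})) * ?P a)"
    by (simp add: sum_subtractf left_diff_distrib)
  also have "\<dots> = (\<Sum>a\<in>draconian m E. (1 - (-1) ^ (card ?C + sum a {1..m})) * ?P a)"
  proof (rule sum_draconian[symmetric])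
    fix a :: "nat \<Rightarrow> nat"
    have "sum (restrict a {1..m}) {1..m} = sum a {1..m}" by (intro sum.cong) auto
    moreover have "?P (restrict a {1..m}) = ?P a" by (intro prod.cong) auto
    ultimately show "(1 - (-1) ^ (card ?C + sum (restrict a {1..m}) {1..m})) * ?P (restrict a {1..m}) =
        (1 - (-1) ^ (card ?C + sum a {1..m})) * ?P a"
      by (simp only:)
  qed
  finally show ?thesis .
qed

text \<open>The factor is 2 when the parity of the sum of \<open>a\<close> is
  \<open>\<epsilon>\<close>, and 0 otherwise.\<close>

lemma sum_draconian_parity:
  assumes "\<epsilon> < 2"
  shows "(\<Sum>a\<in>draconian m E. (1 - (-1) ^ (Suc \<epsilon> + sum a {1..m})) * int (f a)) =
    int (2 * (\<Sum>a\<in>draconian_parity m E \<epsilon>. f a))"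
proof -
  have "(\<Sum>a\<in>draconian m E. (1 - (-1) ^ (Suc \<epsilon> + sum a {1..m})) * int (f a)) =
      (\<Sum>a\<in>draconian m E. if sum a {1..m} mod 2 = \<epsilon> then 2 * int (f a) else 0)"
  proof (intro sum.cong refl)
    fix a :: "nat \<Rightarrow> nat"
    have "(-1) ^ (Suc \<epsilon> + n) = (if n mod 2 = \<epsilon> then -1 else 1 :: int)" for n
    proof -
      have "even (Suc \<epsilon> + n) \<longleftrightarrow> n mod 2 \<noteq> \<epsilon>" using assms by presburger
      then show ?thesis by (cases "n mod 2 = \<epsilon>") (simp_all only: neg_one_even_power neg_one_odd_power if_True if_False simp_thms)
    qed
    from this[of "sum a {1..m}"]
    show "(1 - (-1) ^ (Suc \<epsilon> + sum a {1..m})) * int (f a) =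
        (if sum a {1..m} mod 2 = \<epsilon> then 2 * int (f a) else 0)"
      by (cases "sum a {1..m} mod 2 = \<epsilon>") (simp_all only: if_True if_False, simp_all)
  qed
  also have "\<dots> = (\<Sum>a\<in>draconian_parity m E \<epsilon>. 2 * int (f a))"
    unfolding draconian_parity_def by (rule sum.inter_filter[symmetric, OF finite_draconian])
  finally show ?thesis by (simp add: sum_distrib_left)
qed

text \<open>\<open>Suc d mod 2\<close> is the parity opposite to that of \<open>d\<close>, so one
  formula covers both cases.\<close>

lemma card_boundary_lattice_points_parity:
  fixes E :: "(nat \<times> 'n::finite) set"
  assumes d: "aff_dim (Q_polytope m E k) = int d"
  shows "card (boundary_lattice_points (Q_polytope m E k)) =
    2 * (\<Sum>a\<in>draconian_parity m E (Suc d mod 2). \<Prod>i=1..m. c (a i) (k i))"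
proof -
  have d': "card (covered m E k) = d" using d by (simp add: aff_dim_Q_polytope)
  have sgn: "(-1) ^ (d + n) = (-1 :: int) ^ (Suc (Suc d mod 2) + n)" for n
    by (simp add: minus_one_power_iff)
  have "int (card (boundary_lattice_points (Q_polytope m E k))) =
      (\<Sum>a\<in>draconian m E. (1 - (-1) ^ (Suc (Suc d mod 2) + sum a {1..m})) * int (\<Prod>i=1..m. c (a i) (k i)))"
    unfolding card_boundary_lattice_points d' sgn of_nat_prod ..
  also have "\<dots> = int (2 * (\<Sum>a\<in>draconian_parity m E (Suc d mod 2). \<Prod>i=1..m. c (a i) (k i)))"
    by (rule sum_draconian_parity) simp
  finally show ?thesis unfolding of_nat_eq_iff .
qed

text \<open>A single integer of absolute value \<open>a i\<close> can be chosen in two ways if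
  \<open>a i > 0\<close> and in one way otherwise, so the product is 2 to the number of positive
  coordinates.\<close>

lemma poly_F_poly: "poly (F_poly m E \<epsilon>) 2 = (\<Sum>a\<in>draconian_parity m E \<epsilon>. \<Prod>i=1..m. c (a i) 1)"
proof -
  have "(\<Prod>i=1..m. c (a i) 1) = 2 ^ num_pos m a" for a
    by (simp only: c_one num_pos_def) (rule prod_if_zero_one_two, simp)
  then show ?thesis by (simp add: F_poly_def poly_sum poly_monom)
qed

theorem corollary4p17:
  fixes m :: nat and E :: "(nat \<times> 'n::finite) set"
  assumes "bipartite_graph m E"
  shows "(\<forall>(k :: nat \<Rightarrow> nat) (d :: nat). aff_dim (Q_polytope m E k) = int d \<longrightarrow>
            card (boundary_lattice_points (Q_polytope m E k)) =
              (if even d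
               then 2 * (\<Sum>a\<in>draconian_parity m E 1. \<Prod>i=1..m. c (a i) (k i))
               else 2 * (\<Sum>a\<in>draconian_parity m E 0. \<Prod>i=1..m. c (a i) (k i)))) \<and>
         (\<forall>d :: nat. aff_dim (Q_polytope m E (\<lambda>_. 1)) = int d \<longrightarrow>
            card (boundary_lattice_points (Q_polytope m E (\<lambda>_. 1))) =
              (if even d
               then 2 * poly (F_poly m E 1) 2
               else 2 * poly (F_poly m E 0) 2))"
proof -
  have "Suc d mod 2 = (if even d then 1 else 0)" for d by presburger
  then show ?thesis
    using card_boundary_lattice_points_parity[of m E] by (simp add: poly_F_poly)
qed

end
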